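(* Let $a,b,c\in\mathbb N=\{1,2,\dots\}$, and let $g(z)=g_{\mathcal C_2}(z)$ be the generating function of the Markov-Dyck code $\mathcal C_2$ at the vertex $2$ of the directed graph with adjacency matrix $F(a,b,c)=\begin{bmatrix}a&b\\c&0\end{bmatrix}$. Then $g$ is the solution vanishing at the origin $z=0$ of $$a\,g(z)^3-(a+c)\,g(z)^2+c\big(1+(c-b)z^2\big)g(z)-c^2z^2=0,$$ and the zeta function of the Markov-Dyck shift $D_{F(a,b,c)}$ is $$\zeta_{D_{F(a,b,c)}}(z)=\frac{c\,g(z)\,(1-g(z))}{\big(a\,g(z)^2-(a+c(1+b)z)\,g(z)+cz\big)^2}.$$
   Context: $D_{F(a,b,c)}$ is the Markov-Dyck shift of the directed graph $G$ with vertices $1,2$, with $a$ loops at $1$, $b$ edges from $1$ to $2$, $c$ edges from $2$ to $1$, and no loops at $2$. Markov-Dyck shift: let $G$ be a finite directed graph with vertex set $\mathcal V$ and edge set $\mathcal E$; $s(e)$ and $r(e)$ are the initial and final vertex of $e$. Take two copies $\mathcal E^-=\{e^-:e\in\mathcal E\}$ and $\mathcal E^+=\{e^+:e\in\mathcal E\}$, where $e^-$ goes from $s(e)$ to $r(e)$ and $e^+$ goes from $r(e)$ to $s(e)$. The graph inverse semigroup of $G$ is the semigroup with zero generated by $\mathcal E^-\cup\{P_u:u\in\mathcal V\}\cup\mathcal E^+$ with relations $P_u^2=P_u$, $P_uP_w=0$ for $u\neq w$; $P_{s(e)}e^-=e^-=e^-P_{r(e)}$ and $P_{r(e)}e^+=e^+=e^+P_{s(e)}$;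 $f^-f^+=P_{s(f)}$ and $f^-g^+=0$ for $f\ne g$; consequently $g^+f^-=0$ if $s(f)\neq s(g)$, $f^-g^-=0$ if $r(f)\ne s(g)$, and $f^+g^+=0$ if $s(f)\neq r(g)$. $D_G$ is the subshift over the alphabet $\mathcal E^-\cup\mathcal E^+$ whose admissible words are exactly the words whose product in this semigroup is nonzero. For $v\in\mathcal V$ the Markov-Dyck code $\mathcal C_v$ is the set of nonempty words $(c_k)_{1\le k\le K}$ over $\mathcal E^-\cup\mathcal E^+$ with $\prod_{1\le k\le K}c_k=P_v$ and $\prod_{1\le j\le J}c_j\neq P_v$ for $1\le J<K$. Its generating function is $g_{\mathcal C_v}(z)=\sum_{n\ge0}\#\{w\in\mathcal C_v:\ell(w)=n\}z^n$, with $\ell(w)$ the length of $w$. For a subshift $X$, $\Pi_n(X)$ is the number of points of period $n$ (points fixed by the $n$-th power of the shift), and $\zeta_X(z)=\exp\big(\sum_{n\ge1}\Pi_n(X)z^n/n\big)$. The identities are identities of power series in $z$ (equivalently, near $z=0$). *)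

theory Defs
  imports "Graph_Theory.Digraph" "HOL-Computational_Algebra.Formal_Power_Series"
begin

section \<open>The graph inverse semigroup\<close>

text \<open>
  Graphs are the multi-digraphs of \<^theory>\<open>Graph_Theory.Digraph\<close>, with \<open>s = tail G\<close> and
  \<open>r = head G\<close>.  \<open>Minus e\<close>, \<open>Plus e\<close> and \<open>Idem v\<close> stand for \<open>e\<^sup>-\<close>, \<open>e\<^sup>+\<close> and \<open>P\<^sub>v\<close>.
  A presentation of a semigroup with zero is a presentation of a semigroup with one more
  generator \<open>Null\<close> that is made absorbing by the relations.
\<close>

definition adjacency :: "('v, 'e) pre_digraph \<Rightarrow> 'v \<Rightarrow> 'v \<Rightarrow> nat" where
  "adjacency G u v = card {e \<in> arcs G. tail G e = u \<and> head G e = v}"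

datatype ('v, 'e) gen = Minus 'e | Idem 'v | Plus 'e | Null

definition letters :: "('v, 'e) pre_digraph \<Rightarrow> ('v, 'e) gen set" where
  "letters G = Minus ` arcs G \<union> Plus ` arcs G"

definition gens :: "('v, 'e) pre_digraph \<Rightarrow> ('v, 'e) gen set" where
  "gens G = letters G \<union> Idem ` verts G \<union> {Null}"

inductive gis_rel :: "('v, 'e) pre_digraph \<Rightarrow> ('v, 'e) gen list \<Rightarrow> ('v, 'e) gen list \<Rightarrow> bool"
  for G where
  null_left:      "x \<in> gens G \<Longrightarrow> gis_rel G [Null, x] [Null]"
| null_right:     "x \<in> gens G \<Longrightarrow> gis_rel G [x, Null] [Null]"
| idem:           "u \<in> verts G \<Longrightarrow> gis_rel G [Idem u, Idem u] [Idem u]"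
| idem_orth:      "u \<in> verts G \<Longrightarrow> w \<in> verts G \<Longrightarrow> u \<noteq> w \<Longrightarrow> gis_rel G [Idem u, Idem w] [Null]"
| minus_left:     "e \<in> arcs G \<Longrightarrow> gis_rel G [Idem (tail G e), Minus e] [Minus e]"
| minus_right:    "e \<in> arcs G \<Longrightarrow> gis_rel G [Minus e, Idem (head G e)] [Minus e]"
| plus_left:      "e \<in> arcs G \<Longrightarrow> gis_rel G [Idem (head G e), Plus e] [Plus e]"
| plus_right:     "e \<in> arcs G \<Longrightarrow> gis_rel G [Plus e, Idem (tail G e)] [Plus e]"
| minus_plus:     "f \<in> arcs G \<Longrightarrow> gis_rel G [Minus f, Plus f] [Idem (tail G f)]"
| minus_plus_neq: "f \<in> arcs G \<Longrightarrow> g \<in> arcs G \<Longrightarrow> f \<noteq> g \<Longrightarrow> gis_rel G [Minus f, Plus g] [Null]"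

inductive gis_step :: "('v, 'e) pre_digraph \<Rightarrow> ('v, 'e) gen list \<Rightarrow> ('v, 'e) gen list \<Rightarrow> bool"
  for G where
  "gis_rel G u v \<Longrightarrow> xs \<in> lists (gens G) \<Longrightarrow> ys \<in> lists (gens G)
    \<Longrightarrow> gis_step G (xs @ u @ ys) (xs @ v @ ys)"

text \<open>
  The elements of the semigroup are the classes of nonempty words over \<^term>\<open>gens G\<close> under the
  congruence generated by the relations; multiplication is induced by concatenation, so
  \<open>gis_prod G w\<close> is the product of the entries of \<open>w\<close>.
\<close>

definition gis_prod :: "('v, 'e) pre_digraph \<Rightarrow> ('v, 'e) gen list \<Rightarrow> ('v, 'e) gen list set" where
  "gis_prod G w = {u. equivclp (gis_step G) w u}"

section \<open>Markov-Dyck shifts and Markov-Dyck codes\<close>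

text \<open>Two-sided sequences all of whose finite subwords have a nonzero product.\<close>

definition markov_dyck_shift :: "('v, 'e) pre_digraph \<Rightarrow> (int \<Rightarrow> ('v, 'e) gen) set" where
  "markov_dyck_shift G =
    {x. (\<forall>i. x i \<in> letters G) \<and> (\<forall>i j. i \<le> j \<longrightarrow> gis_prod G (map x [i..j]) \<noteq> gis_prod G [Null])}"

definition markov_dyck_code :: "('v, 'e) pre_digraph \<Rightarrow> 'v \<Rightarrow> ('v, 'e) gen list set" where
  "markov_dyck_code G v =
    {w \<in> lists (letters G). w \<noteq> [] \<and> gis_prod G w = gis_prod G [Idem v] \<and>
      (\<forall>j. 1 \<le> j \<and> j < length w \<longrightarrow> gis_prod G (take j w) \<noteq> gis_prod G [Idem v])}"

definition gen_fun :: "'l list set \<Rightarrow> complex fps" where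
  "gen_fun C = Abs_fps (\<lambda>n. of_nat (card {w \<in> C. length w = n}))"

section \<open>The zeta function of a subshift\<close>

definition shift_map :: "(int \<Rightarrow> 'l) \<Rightarrow> int \<Rightarrow> 'l" where
  "shift_map x = (\<lambda>i. x (i + 1))"

definition num_periodic :: "(int \<Rightarrow> 'l) set \<Rightarrow> nat \<Rightarrow> nat" where
  "num_periodic X n = card {x \<in> X. (shift_map ^^ n) x = x}"

definition zeta :: "(int \<Rightarrow> 'l) set \<Rightarrow> complex fps" where
  "zeta X = fps_exp 1 oo
     Abs_fps (\<lambda>n. if n = 0 then 0 else of_nat (num_periodic X n) / of_nat n)"

end

theory Submission
  imports Defs
begin

unbundle fps_syntax

text \<open>
  Every nonzero element of the graph inverse semigroup is a path of plus arcs followed by a path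
  of minus arcs, and this normal form can be computed letter by letter: the pending minus arcs
  form a stack, a minus letter pushes, and a plus letter cancels the top of the stack or, if the
  stack is empty, lengthens the plus part for good.  The partial function \<open>run\<close> performs this
  computation; it respects the defining relations, and hence it solves the word problem
  (\<open>nonzero_iff\<close>, \<open>gis_prod_eq_Idem_iff\<close>).

  All counting goes through two families of words, read from a vertex \<open>v\<close>: the closed words,
  whose product is \<open>P\<^sub>v\<close>, and the rising words, whose product is a possibly empty plus path from
  \<open>v\<close> back to \<open>v\<close>; the empty word belongs to both.  Both families are
  submonoids \<open>M\<close> of the free monoid that are left unitary and very pure (if \<open>xy\<close> and \<open>yx\<close> are in \<open>M\<close>, so is \<open>x\<close>).  Such an \<open>M\<close> is freely generated by a circular
  code, its set of primes.  If the primes have generating function \<open>g\<close>, then \<open>M\<close> has generating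
  function \<open>1 / (1 - g)\<close>, and the words with a cyclic rotation in \<open>M\<close> are counted by
  \<open>z g' / (1 - g)\<close>, which is \<open>z\<close> times the logarithmic derivative of \<open>1 / (1 - g)\<close>
  (\<open>gen_fun_submonoid\<close>, \<open>conjugates_fps\<close>).

  The primes of the closed words at \<open>v\<close> are the Markov-Dyck code at \<open>v\<close>.  They have the form
  \<open>e\<^sup>- d e\<^sup>+\<close> with \<open>d\<close> closed at \<open>r(e)\<close>, so that, writing \<open>D\<^sub>v = 1 / (1 - g\<^sub>v)\<close>,
    \<open>g\<^sub>1 = z\<^sup>2 (a D\<^sub>1 + b D\<^sub>2)\<close>  and  \<open>g\<^sub>2 = c z\<^sup>2 D\<^sub>1\<close>;
  eliminating \<open>g\<^sub>1\<close> gives the cubic equation.  Since there is no loop at \<open>2\<close>, a rising word at \<open>1\<close>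
  that climbs returns to \<open>1\<close> after at most two permanent plus letters.  Its primes are therefore
  those of the closed words, the loops \<open>e\<^sup>+\<close>, and the words \<open>e\<^sup>+ d f\<^sup>+\<close> with \<open>d\<close> closed at \<open>2\<close>; their
  generating function is \<open>h = g\<^sub>1 + a z + b c z\<^sup>2 D\<^sub>2\<close>.

  A periodic point is determined by a word all of whose powers are nonzero.  Its drift, the number
  of plus letters minus the number of minus letters, decides its kind.  Every such word with
  nonnegative drift has a rotation that is rising at \<open>1\<close> or closed at \<open>2\<close>; the reversal
  \<open>e\<^sup>- \<leftrightarrow> e\<^sup>+\<close> of the semigroup exchanges the two signs of the drift; and the rotations of
  words closed at \<open>1\<close> are exactly what the rising family and its mirror image share.  Hence, by
  inclusion and exclusion (\<open>card_recurrent\<close>),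
    \<open>\<zeta> = (1 - g\<^sub>1) / ((1 - h)\<^sup>2 (1 - g\<^sub>2))\<close>,
  and with the equations for \<open>g\<^sub>1\<close> and \<open>g\<^sub>2\<close> this turns into the stated quotient.
\<close>

section \<open>Normal forms in the graph inverse semigroup\<close>

text \<open>
  A state \<open>(p, h, m)\<close> stands for the product of the plus arcs of \<open>p\<close> in the order of the list, the
  idempotent at the vertex \<open>h\<close> where the two parts meet, and the minus arcs of \<open>m\<close>, most recent
  first.  \<open>act\<close> is right multiplication by a generator, with \<open>None\<close> for the zero element.
\<close>

type_synonym ('v, 'e) state = "'e list \<times> 'v \<times> 'e list"

fun end_vertex :: "('v, 'e) pre_digraph \<Rightarrow> 'v \<Rightarrow> 'e list \<Rightarrow> 'v" where
  "end_vertex G h [] = h"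
| "end_vertex G h (e # m) = head G e"

fun act :: "('v, 'e) pre_digraph \<Rightarrow> ('v, 'e) gen \<Rightarrow> ('v, 'e) state \<Rightarrow> ('v, 'e) state option" where
  "act G (Minus e) (p, h, m) = (if tail G e = end_vertex G h m then Some (p, h, e # m) else None)"
| "act G (Plus e) (p, h, []) = (if head G e = h then Some (p @ [e], tail G e, []) else None)"
| "act G (Plus e) (p, h, f # m) =
     (if f = e \<and> tail G e = end_vertex G h m then Some (p, h, m) else None)"
| "act G (Idem u) (p, h, m) = (if u = end_vertex G h m then Some (p, h, m) else None)"
| "act G Null s = None"

fun run :: "('v, 'e) pre_digraph \<Rightarrow> ('v, 'e) gen list \<Rightarrow> ('v, 'e) state \<Rightarrow> ('v, 'e) state option" where
  "run G [] s = Some s"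
| "run G (x # w) s = Option.bind (act G x s) (run G w)"

lemma gens_iff [simp]:
  "Minus e \<in> gens G \<longleftrightarrow> e \<in> arcs G" "Plus e \<in> gens G \<longleftrightarrow> e \<in> arcs G"
  "Idem v \<in> gens G \<longleftrightarrow> v \<in> verts G" "Null \<in> gens G"
  by (auto simp: gens_def letters_def)

lemma letters_iff [simp]:
  "Minus e \<in> letters G \<longleftrightarrow> e \<in> arcs G" "Plus e \<in> letters G \<longleftrightarrow> e \<in> arcs G"
  "Idem v \<notin> letters G" "Null \<notin> letters G"
  by (auto simp: letters_def)

lemma letters_subset_gens: "letters G \<subseteq> gens G"
  by (auto simp: gens_def)

lemma run_append: "run G (xs @ ys) s = Option.bind (run G xs s) (run G ys)"
  by (induction xs arbitrary: s) (auto split: bind_splits)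

text \<open>
  The check of the tail in the cancelling case of \<open>act\<close> makes this hold on all states, also on
  those that are not normal forms; no invariant has to be carried along.
\<close>

lemma run_gis_rel: "gis_rel G u v \<Longrightarrow> run G u s = run G v s"
proof (cases s)
  case (fields p h m)
  assume "gis_rel G u v"
  then show ?thesis unfolding fields
    by cases (cases m; auto split: bind_splits)+
qed

lemma run_equivclp: "equivclp (gis_step G) u v \<Longrightarrow> run G u s = run G v s"
proof (induction rule: equivclp_induct)
  case (step y z)
  have "run G y s = run G z s" if "gis_step G y z" for y z
    using that
  proof cases
    case (1 u v xs ys)
    have "run G u t = run G v t" for t using run_gis_rel[OF 1(3)] by blast
    then have "run G (u @ ys) = run G (v @ ys)" by (simp add: fun_eq_iff run_append)
    then show ?thesis unfolding 1 by (simp add: run_append[of _ xs])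
  qed
  with step show ?case by metis
qed simp

text \<open>
  Products are equivalence classes, so that equality of products is the congruence itself; all
  reasoning in the semigroup below is done with the congruence.
\<close>

lemma gis_prod_eq_iff: "gis_prod G u = gis_prod G v \<longleftrightarrow> equivclp (gis_step G) u v"
  unfolding gis_prod_def by (metis (mono_tags) equivclp_refl equivclp_sym equivclp_trans mem_Collect_eq subset_antisym subsetI)

lemma equivclp_ctx:
  assumes "equivclp (gis_step G) u v" "xs \<in> lists (gens G)" "ys \<in> lists (gens G)"
  shows "equivclp (gis_step G) (xs @ u @ ys) (xs @ v @ ys)"
  using assms(1)
proof (induction rule: equivclp_induct)
  case (step y z)
  have "gis_step G (xs @ y @ ys) (xs @ z @ ys)" if "gis_step G y z" for y z
    using that
  proof cases
    case (1 u v xs' ys')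
    have "gis_step G ((xs @ xs') @ u @ (ys' @ ys)) ((xs @ xs') @ v @ (ys' @ ys))"
      by (rule gis_step.intros) (use 1 assms in auto)
    then show ?thesis unfolding 1 by simp
  qed
  with step show ?case by (meson equivclp_into_equivclp)
qed simp

lemma gis_rel_ctx:
  assumes "gis_rel G u v" "xs \<in> lists (gens G)" "ys \<in> lists (gens G)"
  shows "equivclp (gis_step G) (xs @ u @ ys) (xs @ v @ ys)"
  using assms by (intro r_into_equivclp gis_step.intros)

lemma null_right: "ys \<in> lists (gens G) \<Longrightarrow> equivclp (gis_step G) (Null # ys) [Null]"
proof (induction ys)
  case (Cons y ys)
  have "equivclp (gis_step G) ([] @ [Null, y] @ ys) ([] @ [Null] @ ys)"
    by (rule gis_rel_ctx) (use Cons in \<open>auto intro: gis_rel.intros\<close>)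
  with Cons show ?case by (auto intro: equivclp_trans)
qed simp

lemma null_left: "xs \<in> lists (gens G) \<Longrightarrow> equivclp (gis_step G) (xs @ [Null]) [Null]"
proof (induction xs rule: rev_induct)
  case (snoc x xs)
  have "equivclp (gis_step G) (xs @ [x, Null] @ []) (xs @ [Null] @ [])"
    by (rule gis_rel_ctx) (use snoc in \<open>auto intro: gis_rel.intros\<close>)
  with snoc show ?case by (auto intro: equivclp_trans)
qed simp

lemma null_ctx:
  assumes "equivclp (gis_step G) u [Null]" "xs \<in> lists (gens G)" "ys \<in> lists (gens G)"
  shows "equivclp (gis_step G) (xs @ u @ ys) [Null]"
proof -
  have 1: "equivclp (gis_step G) (xs @ u @ ys) (xs @ [Null] @ ys)"
    using assms by (rule equivclp_ctx)
  have 2: "equivclp (gis_step G) ([] @ (xs @ [Null]) @ ys) ([] @ [Null] @ ys)"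
    using assms null_left by (intro equivclp_ctx) auto
  show ?thesis using 1 2 null_right[OF assms(3)] by (auto intro: equivclp_trans)
qed

fun chain :: "('v, 'e) pre_digraph \<Rightarrow> 'v \<Rightarrow> 'e list \<Rightarrow> bool" where
  "chain G h [] = True"
| "chain G h (e # m) = (tail G e = end_vertex G h m \<and> chain G h m)"

definition valid :: "('v, 'e) pre_digraph \<Rightarrow> ('v, 'e) state \<Rightarrow> bool" where
  "valid G = (\<lambda>(p, h, m). h \<in> verts G \<and> set p \<subseteq> arcs G \<and> set m \<subseteq> arcs G \<and> chain G h m)"

definition normal_word :: "('v, 'e) state \<Rightarrow> ('v, 'e) gen list" where
  "normal_word = (\<lambda>(p, h, m). map Plus p @ Idem h # map Minus (rev m))"

lemma normal_word_gens: "valid G s \<Longrightarrow> normal_word s \<in> lists (gens G)"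
  by (cases s) (auto simp: valid_def normal_word_def subset_iff)

text \<open>
  The idempotent at the end vertex of a normal form may be split off on the right.  It makes the
  endpoint of the path visible to the relations, which then decide the product with any generator.
\<close>

lemma normal_word_end:
  assumes "valid G (p, h, m)"
  shows "equivclp (gis_step G) (normal_word (p, h, m)) (normal_word (p, h, m) @ [Idem (end_vertex G h m)])"
proof (cases m)
  case Nil
  have "equivclp (gis_step G) (map Plus p @ [Idem h, Idem h] @ []) (map Plus p @ [Idem h] @ [])"
    using assms by (intro gis_rel_ctx gis_rel.intros) (auto simp: valid_def subset_iff)
  with Nil show ?thesis by (simp add: normal_word_def equivclp_sym)
next
  case (Cons e m')
  have "equivclp (gis_step G) (normal_word (p, h, m') @ [Minus e, Idem (head G e)] @ []) (normal_word (p, h, m') @ [Minus e] @ [])"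
    using assms Cons normal_word_gens[of G "(p, h, m')"]
    by (intro gis_rel_ctx gis_rel.intros) (auto simp: valid_def subset_iff)
  with Cons show ?thesis by (simp add: normal_word_def equivclp_sym)
qed

lemma normal_word_step_None:
  assumes wf: "wf_digraph G" and v: "valid G (p, h, m)" and x: "x \<in> gens G" and a: "act G x (p, h, m) = None"
  shows "equivclp (gis_step G) (normal_word (p, h, m) @ [x]) [Null]"
proof -
  interpret wf_digraph G by (rule wf)
  let ?N = "normal_word (p, h, m)" and ?c = "end_vertex G h m"
  have N: "?N \<in> lists (gens G)" using v by (rule normal_word_gens)
  have c: "?c \<in> verts G" using v by (cases m) (auto simp: valid_def)
  have orth: "equivclp (gis_step G) (?N @ [Idem u] @ ys) [Null]"
    if u: "u \<in> verts G" "u \<noteq> ?c" and ys: "ys \<in> lists (gens G)" for u ys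
  proof -
    have 1: "equivclp (gis_step G) ([] @ ?N @ ([Idem u] @ ys)) ([] @ (?N @ [Idem ?c]) @ ([Idem u] @ ys))"
      by (rule equivclp_ctx[OF normal_word_end[OF v]]) (use u ys in auto)
    have 2: "equivclp (gis_step G) (?N @ [Idem ?c, Idem u] @ ys) [Null]"
      by (rule null_ctx[OF r_into_equivclp]) (use u ys c N in \<open>auto intro: gis_rel.intros gis_step.intros[of _ _ _ "[]" "[]", simplified]\<close>)
    show ?thesis using equivclp_trans[OF 1] 2 by simp
  qed
  have ins: "equivclp (gis_step G) (?N @ [Idem u] @ [x]) [Null] \<Longrightarrow> gis_rel G [Idem u, x] [x] \<Longrightarrow> ?thesis" for u
    using gis_rel_ctx[of G "[Idem u, x]" "[x]" ?N "[]"] N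
    by (auto intro: equivclp_trans equivclp_sym)
  show ?thesis
  proof (cases x)
    case (Minus e)
    then show ?thesis using a x by (intro ins[OF orth]) (auto intro: gis_rel.intros split: if_splits)
  next
    case (Idem u)
    then show ?thesis using a x orth[of u "[]"] by (auto split: if_splits)
  next
    case (Plus e)
    show ?thesis
    proof (cases m)
      case Nil
      then show ?thesis using a x Plus by (intro ins[OF orth]) (auto intro: gis_rel.intros split: if_splits)
    next
      case (Cons f m')
      then have f: "f \<in> arcs G" "f \<noteq> e" using v a Plus by (auto simp: valid_def split: if_splits)
      have "equivclp (gis_step G) (normal_word (p, h, m') @ [Minus f, Plus e] @ []) [Null]"
        by (rule null_ctx[OF r_into_equivclp])
           (use f x v Plus Cons normal_word_gens[of G "(p, h, m')"]
            in \<open>auto simp: valid_def intro: gis_rel.intros gis_step.intros[of _ _ _ "[]" "[]", simplified]\<close>)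
      then show ?thesis using Cons Plus by (simp add: normal_word_def)
    qed
  next
    case Null
    then show ?thesis using N by (simp add: null_left)
  qed
qed

lemma normal_word_step_Some:
  assumes wf: "wf_digraph G" and v: "valid G (p, h, m)" and x: "x \<in> gens G" and a: "act G x (p, h, m) = Some s"
  shows "equivclp (gis_step G) (normal_word (p, h, m) @ [x]) (normal_word s) \<and> valid G s"
proof -
  interpret wf_digraph G by (rule wf)
  show ?thesis
  proof (cases x)
    case (Minus e)
    then show ?thesis using a x v by (auto simp: normal_word_def valid_def split: if_splits)
  next
    case (Idem u)
    then show ?thesis using a x normal_word_end[OF v] v by (auto intro: equivclp_sym split: if_splits)
  next
    case Null
    then show ?thesis using a by simp
  next
    case (Plus e)
    show ?thesis
    proof (cases m)
      case Nil
      have s: "s = (p @ [e], tail G e, [])" "h = head G e" using a Plus Nil by (auto split: if_splits)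
      have 1: "equivclp (gis_step G) (map Plus p @ [Idem (head G e), Plus e] @ []) (map Plus p @ [Plus e] @ [])"
        using v x Plus by (intro gis_rel_ctx gis_rel.intros) (auto simp: valid_def subset_iff)
      have 2: "equivclp (gis_step G) (map Plus p @ [Plus e, Idem (tail G e)] @ []) (map Plus p @ [Plus e] @ [])"
        using v x Plus by (intro gis_rel_ctx gis_rel.intros) (auto simp: valid_def subset_iff)
      have "equivclp (gis_step G) (map Plus p @ [Idem (head G e), Plus e]) (map Plus p @ [Plus e, Idem (tail G e)])"
        using equivclp_trans[OF 1 equivclp_sym[OF 2]] by simp
      then show ?thesis using v x unfolding s Nil Plus by (auto simp: normal_word_def valid_def)
    next
      case (Cons f m')
      have s: "s = (p, h, m')" "f = e" "e \<in> arcs G" "tail G e = end_vertex G h m'" "valid G s"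
        using a Plus Cons v by (auto simp: valid_def split: if_splits)
      have 1: "equivclp (gis_step G) (normal_word s @ [Minus e, Plus e] @ []) (normal_word s @ [Idem (tail G e)] @ [])"
        using s normal_word_gens[of G s] by (intro gis_rel_ctx gis_rel.intros) auto
      have "equivclp (gis_step G) (normal_word s @ [Minus e, Plus e] @ []) (normal_word s)"
        using equivclp_trans[OF 1] equivclp_sym[OF normal_word_end[of G p h m']] s by simp
      then show ?thesis using s unfolding Cons Plus by (simp add: normal_word_def)
    qed
  qed
qed

text \<open>
  \<open>run\<close> computes in the semigroup: together with \<open>run_equivclp\<close> this is the solution of the word
  problem.  The leading idempotent fixes the vertex where the reduction starts.
\<close>

lemma equivclp_normal_word:
  assumes wf: "wf_digraph G" and u: "u \<in> verts G" and w: "w \<in> lists (gens G)"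
  shows "case run G w ([], u, []) of
           None \<Rightarrow> equivclp (gis_step G) (Idem u # w) [Null]
         | Some s \<Rightarrow> equivclp (gis_step G) (Idem u # w) (normal_word s) \<and> valid G s"
  using w
proof (induction w rule: rev_induct)
  case Nil
  show ?case using u by (simp add: normal_word_def valid_def)
next
  case (snoc x w)
  have x: "x \<in> gens G" using snoc.prems by simp
  show ?case
  proof (cases "run G w ([], u, [])")
    case None
    then have "equivclp (gis_step G) ([] @ (Idem u # w) @ [x]) [Null]"
      using snoc x by (intro null_ctx) auto
    with None show ?thesis by (simp add: run_append)
  next
    case (Some s)
    then have IH: "equivclp (gis_step G) (Idem u # w) (normal_word s)" "valid G s" using snoc by auto
    have 1: "equivclp (gis_step G) ([] @ (Idem u # w) @ [x]) ([] @ normal_word s @ [x])"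
      using IH x by (intro equivclp_ctx) auto
    obtain p h m where s: "s = (p, h, m)" by (cases s)
    show ?thesis
    proof (cases "act G x s")
      case None
      then show ?thesis
        using Some equivclp_trans[OF 1] normal_word_step_None[OF wf _ x, of p h m] IH s
        by (simp add: run_append)
    next
      case (Some s')
      then show ?thesis
        using \<open>run G w ([], u, []) = Some s\<close> equivclp_trans[OF 1] normal_word_step_Some[OF wf _ x, of p h m s'] IH s
        by (simp add: run_append)
    qed
  qed
qed

fun src :: "('v, 'e) pre_digraph \<Rightarrow> ('v, 'e) gen \<Rightarrow> 'v" where
  "src G (Minus e) = tail G e"
| "src G (Plus e) = head G e"
| "src G (Idem v) = v"

lemma act_src: "act G x (p, h, m) = Some s \<Longrightarrow> end_vertex G h m = src G x"
  by (cases x; cases m) (auto split: if_splits)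

lemma equivclp_Idem_src:
  assumes "w \<in> lists (letters G)" "w \<noteq> []"
  shows "equivclp (gis_step G) (Idem (src G (hd w)) # w) w"
proof -
  obtain x xs where w: "w = x # xs" using assms by (cases w) auto
  have "equivclp (gis_step G) ([] @ [Idem (src G x), x] @ xs) ([] @ [x] @ xs)"
  proof (rule gis_rel_ctx)
    show "gis_rel G [Idem (src G x), x] [x]"
      using assms w by (auto simp: letters_def intro: gis_rel.intros)
  qed (use assms w letters_subset_gens in auto)
  then show ?thesis by (simp add: w)
qed

definition nonzero :: "('v, 'e) pre_digraph \<Rightarrow> ('v, 'e) gen list \<Rightarrow> bool" where
  "nonzero G w \<longleftrightarrow> gis_prod G w \<noteq> gis_prod G [Null]"

lemma letters_lists_gens: "w \<in> lists (letters G) \<Longrightarrow> w \<in> lists (gens G)"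
  using letters_subset_gens by auto

lemma src_in_verts: "wf_digraph G \<Longrightarrow> x \<in> letters G \<Longrightarrow> src G x \<in> verts G"
  by (auto simp: letters_def wf_digraph.wellformed)

lemma nonzero_iff:
  assumes wf: "wf_digraph G" and w: "w \<in> lists (letters G)" "w \<noteq> []"
  shows "nonzero G w \<longleftrightarrow> (\<exists>u. run G w ([], u, []) \<noteq> None)"
proof
  assume "\<exists>u. run G w ([], u, []) \<noteq> None"
  then show "nonzero G w"
    unfolding nonzero_def gis_prod_eq_iff using run_equivclp[of G w "[Null]"] by fastforce
next
  assume nz: "nonzero G w"
  let ?u = "src G (hd w)"
  have "?u \<in> verts G" using w by (intro src_in_verts[OF wf]) (cases w; auto)
  then have "run G w ([], ?u, []) \<noteq> None"
    using equivclp_normal_word[OF wf _ letters_lists_gens[OF w(1)], of ?u] nz equivclp_Idem_src[OF w]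
    unfolding nonzero_def gis_prod_eq_iff
    by (auto split: option.splits intro: equivclp_trans equivclp_sym)
  then show "\<exists>u. run G w ([], u, []) \<noteq> None" by blast
qed

lemma gis_prod_eq_Idem_iff:
  assumes wf: "wf_digraph G" and w: "w \<in> lists (letters G)" "w \<noteq> []" and v: "v \<in> verts G"
  shows "gis_prod G w = gis_prod G [Idem v] \<longleftrightarrow> run G w ([], v, []) = Some ([], v, [])"
proof
  assume "gis_prod G w = gis_prod G [Idem v]"
  then have "run G w ([], v, []) = run G [Idem v] ([], v, [])"
    unfolding gis_prod_eq_iff by (rule run_equivclp)
  then show "run G w ([], v, []) = Some ([], v, [])" by simp
next
  assume r: "run G w ([], v, []) = Some ([], v, [])"
  then have "v = src G (hd w)" using w by (cases w) (auto split: bind_splits dest: act_src)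
  moreover have "equivclp (gis_step G) (Idem v # w) [Idem v]"
    using equivclp_normal_word[OF wf v letters_lists_gens[OF w(1)]] r by (simp add: normal_word_def)
  ultimately show "gis_prod G w = gis_prod G [Idem v]"
    unfolding gis_prod_eq_iff using equivclp_Idem_src[OF w] by (auto intro: equivclp_trans equivclp_sym)
qed

lemma nonzero_factor:
  assumes "nonzero G (xs @ w @ ys)" "xs \<in> lists (letters G)" "ys \<in> lists (letters G)"
  shows "nonzero G w"
  using assms null_ctx[of G w xs ys] letters_lists_gens unfolding nonzero_def gis_prod_eq_iff by blast

section \<open>The reversal anti-automorphism\<close>

fun opp :: "('v, 'e) gen \<Rightarrow> ('v, 'e) gen" where
  "opp (Minus e) = Plus e" | "opp (Plus e) = Minus e" | "opp (Idem v) = Idem v" | "opp Null = Null"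

definition mirror :: "('v, 'e) gen list \<Rightarrow> ('v, 'e) gen list" where
  "mirror w = rev (map opp w)"

lemma opp_opp [simp]: "opp (opp x) = x"
  by (cases x) auto

lemma opp_gens [simp]: "opp x \<in> gens G \<longleftrightarrow> x \<in> gens G" "opp x \<in> letters G \<longleftrightarrow> x \<in> letters G"
  by (cases x; auto)+

lemma mirror_simps [simp]:
  "mirror [] = []" "mirror (u @ w) = mirror w @ mirror u" "mirror [x] = [opp x]" "mirror (x # w) = mirror w @ [opp x]"
  "mirror (mirror w) = w" "length (mirror w) = length w"
  "mirror w \<in> lists (gens G) \<longleftrightarrow> w \<in> lists (gens G)"
  "mirror w \<in> lists (letters G) \<longleftrightarrow> w \<in> lists (letters G)"
  by (auto simp: mirror_def rev_map o_def)

lemma gis_rel_mirror: "gis_rel G u v \<Longrightarrow> gis_rel G (mirror u) (mirror v)"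
  by (induction rule: gis_rel.induct) (auto intro: gis_rel.intros)

text \<open>
  Every defining relation is mapped to a defining relation by reversing words and exchanging
  \<open>e\<^sup>-\<close> with \<open>e\<^sup>+\<close>.  This gives the symmetry between periodic points of positive and of negative
  drift.
\<close>

lemma equivclp_mirror: "equivclp (gis_step G) u v \<Longrightarrow> equivclp (gis_step G) (mirror u) (mirror v)"
proof (induction rule: equivclp_induct)
  case (step y z)
  have "gis_step G (mirror y) (mirror z)" if "gis_step G y z" for y z
    using that
  proof cases
    case (1 u v xs ys)
    have "gis_step G (mirror ys @ mirror u @ mirror xs) (mirror ys @ mirror v @ mirror xs)"
      using 1 gis_rel_mirror by (intro gis_step.intros) auto
    then show ?thesis by (simp add: 1)
  qed
  with step show ?case by (meson equivclp_into_equivclp)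
qed simp

lemma equivclp_mirror_iff: "equivclp (gis_step G) (mirror u) (mirror v) \<longleftrightarrow> equivclp (gis_step G) u v"
  using equivclp_mirror[of G u v] equivclp_mirror[of G "mirror u" "mirror v"] by auto

lemma nonzero_mirror [simp]: "nonzero G (mirror w) \<longleftrightarrow> nonzero G w"
  using equivclp_mirror_iff[of G w "[Null]"] by (simp add: nonzero_def gis_prod_eq_iff)

lemma gis_prod_mirror_Idem: "gis_prod G (mirror w) = gis_prod G [Idem v] \<longleftrightarrow> gis_prod G w = gis_prod G [Idem v]"
  using equivclp_mirror_iff[of G w "[Idem v]"] by (simp add: gis_prod_eq_iff)

section \<open>Reduction of words\<close>

lemma act_prefix:
  "act G x (q @ p, h, m) = map_option (\<lambda>(p', s). (q @ p', s)) (act G x (p, h, m))"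
  by (cases x; cases m) auto

text \<open>
  The plus part is only ever extended, never read, so an initial segment of it can be carried along
  unchanged.
\<close>

lemma run_prefix:
  "run G w (q @ p, h, m) = map_option (\<lambda>(p', s). (q @ p', s)) (run G w (p, h, m))"
proof (induction w arbitrary: p h m)
  case (Cons x w)
  show ?case
    by (cases "act G x (p, h, m)") (auto simp: act_prefix Cons.IH)
qed simp

lemma run_prefix': "run G w (q, h, m) = map_option (\<lambda>(p', s). (q @ p', s)) (run G w ([], h, m))"
  using run_prefix[of G w q "[]" h m] by simp

lemma act_grows: "act G x (p, h, m) = Some (p', h', m') \<Longrightarrow> \<exists>q. p' = p @ q \<and> (q = [] \<longrightarrow> h' = h)"
  by (cases x; cases m) (auto split: if_splits)

lemma run_grows: "run G w (p, h, m) = Some (p', h', m') \<Longrightarrow> \<exists>q. p' = p @ q \<and> (q = [] \<longrightarrow> h' = h)"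
proof (induction w arbitrary: p h m)
  case (Cons x w)
  then obtain p1 h1 m1 where 1: "act G x (p, h, m) = Some (p1, h1, m1)" "run G w (p1, h1, m1) = Some (p', h', m')"
    by (auto split: bind_splits)
  show ?case using act_grows[OF 1(1)] Cons.IH[OF 1(2)] by auto
qed simp

lemma run_Nil_grows: "run G w ([], h, m) = Some ([], h', m') \<Longrightarrow> h' = h"
  using run_grows[of G w "[]" h m "[]" h' m'] by auto

lemma run_prefix_Nil:
  assumes "run G (u @ w) ([], h, m) = Some ([], h', m')"
  obtains m1 where "run G u ([], h, m) = Some ([], h, m1)" "run G w ([], h, m1) = Some ([], h, m')" "h' = h"
proof -
  obtain p1 h1 m1 where 1: "run G u ([], h, m) = Some (p1, h1, m1)" "run G w (p1, h1, m1) = Some ([], h', m')"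
    using assms by (auto simp: run_append split: bind_splits)
  have "p1 = []" using run_grows[OF 1(2)] by auto
  with 1 that show ?thesis using run_Nil_grows assms by metis
qed

lemma run_snoc_Some:
  assumes "run G (w @ [x]) s = Some t"
  obtains r where "run G w s = Some r" "act G x r = Some t"
  using assms by (auto simp: run_append split: bind_splits)

lemma end_vertex_append: "end_vertex G k (m @ s) = end_vertex G (end_vertex G k s) m"
  by (cases m) auto

text \<open>
  A word that reduces to minus letters alone never touches what lies below it on the stack.
\<close>

lemma run_on_stack:
  assumes "run G w ([], u, []) = Some ([], h, m)" "end_vertex G k s = u"
  shows "run G w (q, k, s) = Some (q, k, m @ s)"
  using assms(1)
proof (induction w arbitrary: m h rule: rev_induct)
  case Nil
  then show ?case by simp
next
  case (snoc x w)
  obtain m1 where 1: "run G w ([], u, []) = Some ([], u, m1)" "run G [x] ([], u, m1) = Some ([], u, m)"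
    using run_prefix_Nil[OF snoc.prems] by metis
  have "run G w (q, k, s) = Some (q, k, m1 @ s)" using snoc.IH[OF 1(1)] .
  moreover have "act G x (q, k, m1 @ s) = Some (q, k, m @ s)"
    using 1(2) assms(2) by (cases x; cases m1) (auto simp: end_vertex_append split: if_splits bind_splits)
  ultimately show ?case by (simp add: run_append)
qed

text \<open>
  What a word pushes permanently when it starts from the empty stack, it also pushes from any
  other state on which it is defined.
\<close>

lemma run_stack_prefix:
  assumes "run G w ([], u, []) = Some (p, h, m)" "run G w (p2, h2, m2) = Some (p3, h3, m3)"
  shows "\<exists>r. m3 = m @ r"
  using assms
proof (induction w arbitrary: p h m p3 h3 m3 rule: rev_induct)
  case Nil
  then show ?case by simp
next
  case (snoc x w)
  obtain p' h' m' where 1: "run G w ([], u, []) = Some (p', h', m')" "act G x (p', h', m') = Some (p, h, m)"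
    using run_snoc_Some[OF snoc.prems(1)] by (metis prod_cases3)
  obtain p4 h4 m4 where 2: "run G w (p2, h2, m2) = Some (p4, h4, m4)" "act G x (p4, h4, m4) = Some (p3, h3, m3)"
    using run_snoc_Some[OF snoc.prems(2)] by (metis prod_cases3)
  obtain r where "m4 = m' @ r" using snoc.IH[OF 1(1) 2(1)] by blast
  with 1(2) 2(2) show ?case by (cases x; cases m') (auto split: if_splits)
qed

fun tgt :: "('v, 'e) pre_digraph \<Rightarrow> ('v, 'e) gen \<Rightarrow> 'v" where
  "tgt G (Minus e) = head G e"
| "tgt G (Plus e) = tail G e"
| "tgt G (Idem v) = v"

lemma act_tgt: "act G x (p, h, m) = Some (p', h', m') \<Longrightarrow> end_vertex G h' m' = tgt G x"
  by (cases x; cases m) (auto split: if_splits)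

lemma run_tgt: "w \<noteq> [] \<Longrightarrow> run G w (p, h, m) = Some (p', h', m') \<Longrightarrow> end_vertex G h' m' = tgt G (last w)"
proof -
  assume "w \<noteq> []" and r: "run G w (p, h, m) = Some (p', h', m')"
  then have w: "w = butlast w @ [last w]" by simp
  obtain s where "act G (last w) s = Some (p', h', m')" using r by (subst (asm) w) (erule run_snoc_Some)
  then show ?thesis by (cases s) (auto dest: act_tgt)
qed

lemma run_src: "w \<noteq> [] \<Longrightarrow> run G w (p, h, m) = Some s \<Longrightarrow> end_vertex G h m = src G (hd w)"
  by (cases w) (auto split: bind_splits dest: act_src)

subsection \<open>Closed and rising words\<close>

definition closed_words :: "('v, 'e) pre_digraph \<Rightarrow> 'v \<Rightarrow> ('v, 'e) gen list set" where
  "closed_words G v = {w \<in> lists (letters G). run G w ([], v, []) = Some ([], v, [])}"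

definition rising_words :: "('v, 'e) pre_digraph \<Rightarrow> 'v \<Rightarrow> ('v, 'e) gen list set" where
  "rising_words G v = {w \<in> lists (letters G). \<exists>p. run G w ([], v, []) = Some (p, v, [])}"

lemma closed_subset_rising: "closed_words G v \<subseteq> rising_words G v"
  by (auto simp: closed_words_def rising_words_def)

lemma run_closed:
  assumes "d \<in> closed_words G u" "run G d (q, k, s) = Some t"
  shows "t = (q, k, s)"
proof (cases "d = []")
  case False
  have "end_vertex G k s = u"
    using run_src[OF False assms(2)] run_src[OF False, of G "[]" u "[]"] assms(1) by (auto simp: closed_words_def)
  then show ?thesis using run_on_stack[of G d u u "[]"] assms by (auto simp: closed_words_def)
qed (use assms in auto)

text \<open>
  Cutting at the first letter that is not cancelled inside the word: either there is none and the
  word is closed, or the word is a closed word, that letter, and a remainder that can be read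
  from the endpoint of the corresponding arc.
\<close>

lemma run_cases:
  assumes "w \<in> lists (letters G)" "run G w ([], u, []) = Some (p, h, m)"
  obtains (closed) "w \<in> closed_words G u" "p = []" "h = u" "m = []"
  | (plus) d f w2 p' where "w = d @ Plus f # w2" "d \<in> closed_words G u" "head G f = u" "p = f # p'"
      "run G w2 ([], tail G f, []) = Some (p', h, m)"
  | (minus) d e w2 m' where "w = d @ Minus e # w2" "d \<in> closed_words G u" "tail G e = u" "p = []" "h = u"
      "m = m' @ [e]" "run G w2 ([], head G e, []) = Some ([], head G e, m')"
  using assms
proof (induction w arbitrary: p h m thesis rule: rev_induct)
  case Nil
  then show ?case by (simp add: closed_words_def)
next
  case (snoc x w)
  obtain p1 h1 m1 where 1: "run G w ([], u, []) = Some (p1, h1, m1)" "act G x (p1, h1, m1) = Some (p, h, m)"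
    using run_snoc_Some[OF snoc.prems(5)] by (metis prod_cases3)
  have w: "w \<in> lists (letters G)" "x \<in> letters G" using snoc.prems(4) by auto
  consider (closed) "w \<in> closed_words G u" "p1 = []" "h1 = u" "m1 = []"
  | (plus) d f w2 p' where "w = d @ Plus f # w2" "d \<in> closed_words G u" "head G f = u" "p1 = f # p'"
      "run G w2 ([], tail G f, []) = Some (p', h1, m1)"
  | (minus) d e w2 m' where "w = d @ Minus e # w2" "d \<in> closed_words G u" "tail G e = u" "p1 = []" "h1 = u"
      "m1 = m' @ [e]" "run G w2 ([], head G e, []) = Some ([], head G e, m')"
    by (rule snoc.IH[OF _ _ _ w(1) 1(1)])
  then show ?case
  proof cases
    case closed
    show ?thesis
    proof (cases x)
      case (Minus e)
      then show ?thesis using snoc.prems(3)[of w e "[]" "[]"] closed 1 by (auto split: if_splits)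
    next
      case (Plus e)
      then show ?thesis using snoc.prems(2)[of w e "[]" "[]"] closed 1 by (auto split: if_splits)
    qed (use w in auto)
  next
    case plus
    have "map_option (\<lambda>(p', s). ([f] @ p', s)) (act G x (p', h1, m1)) = Some (p, h, m)"
      using act_prefix[of G x "[f]" p' h1 m1] plus(4) 1(2) by simp
    then obtain p'' where p: "act G x (p', h1, m1) = Some (p'', h, m)" "p = f # p''"
      by (auto simp: map_option_eq_Some)
    show ?thesis
      by (rule snoc.prems(2)[of d f "w2 @ [x]"]) (use plus p in \<open>auto simp: run_append\<close>)
  next
    case minus
    show ?thesis
    proof (cases x)
      case (Minus e')
      show ?thesis
        by (rule snoc.prems(3)[of d e "w2 @ [x]" "e' # m'"])
          (use minus 1 Minus in \<open>auto simp: run_append end_vertex_append split: if_splits\<close>)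
    next
      case (Plus e')
      show ?thesis
      proof (cases m')
        case Nil
        have "run G (w @ [x]) ([], u, []) = Some ([], u, [])"
          using minus(4-6) 1 Plus Nil by (subst run_append) (auto split: if_splits)
        then show ?thesis
          using snoc.prems(1) snoc.prems(4,5) by (auto simp: closed_words_def)
      next
        case (Cons g m'')
        show ?thesis
          by (rule snoc.prems(3)[of d e "w2 @ [x]" m''])
            (use minus 1 Plus Cons in \<open>auto simp: run_append end_vertex_append split: if_splits\<close>)
      qed
    qed (use w in auto)
  qed
qed

text \<open>
  The cut is made where the last plus letter of the normal form has been read; there the stack
  is empty.
\<close>

lemma split_at_base:
  assumes "w \<in> lists (letters G)" "run G w ([], u, []) = Some (p, h, m)"
  obtains w1 w2 where "w = w1 @ w2" "run G w1 ([], u, []) = Some (p, h, [])" "run G w2 ([], h, []) = Some ([], h, m)"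
  using assms
proof (induction p arbitrary: w u thesis)
  case Nil
  then show ?case using Nil.prems(1)[of "[]" w] run_Nil_grows[OF Nil.prems(3)] by simp
next
  case (Cons f p)
  show ?case
  proof (cases rule: run_cases[OF Cons.prems(2,3)])
    case (2 d f' w2 p')
    then obtain v1 v2 where v: "w2 = v1 @ v2" "run G v1 ([], tail G f, []) = Some (p, h, [])"
        "run G v2 ([], h, []) = Some ([], h, m)"
      using Cons.IH[of w2 "tail G f"] Cons.prems by auto
    have "run G v1 ([f], tail G f, []) = Some (f # p, h, [])" using v(2) run_prefix'[of G v1 "[f]"] by simp
    then show ?thesis using Cons.prems(1)[of "d @ Plus f # v1" v2] v 2
      by (auto simp: run_append closed_words_def)
  qed auto
qed

text \<open>
  A word with product the plus path \<open>p\<close> first consumes the stack \<open>m\<close> on which it is run.  The run is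
  defined only if the arcs agree, and what remains of \<open>p\<close> extends the plus part.
\<close>

lemma run_popping_word:
  assumes "w \<in> lists (letters G)" "run G w ([], u, []) = Some (p, h, [])" "run G w (q, k, m) = Some (q', h', m')"
    and "length m \<le> length p"
  shows "m' = [] \<and> (w \<noteq> [] \<longrightarrow> h' = h) \<and> (\<exists>t. p = m @ t \<and> q' = q @ t)"
  using assms
proof (induction p arbitrary: w u q k m)
  case Nil
  then have "w \<in> closed_words G u" using run_Nil_grows[OF Nil.prems(2)] by (auto simp: closed_words_def)
  then have "(q', h', m') = (q, k, m)" "m = []" using run_closed[OF _ Nil.prems(3)] Nil.prems(4) by auto
  moreover have "w \<noteq> [] \<Longrightarrow> h' = h"
    using run_tgt[OF _ Nil.prems(2)] run_tgt[OF _ Nil.prems(3)] calculation by auto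
  ultimately show ?case by simp
next
  case (Cons f p)
  show ?case
  proof (cases rule: run_cases[OF Cons.prems(1,2)])
    case (2 d f' w2 p')
    obtain r where r: "run G d (q, k, m) = Some r" using Cons.prems(3) 2 by (auto simp: run_append split: bind_splits)
    with run_closed[OF 2(2) r] Cons.prems(3) 2
    obtain s where s: "act G (Plus f) (q, k, m) = Some s" "run G w2 s = Some (q', h', m')"
      by (auto simp: run_append split: bind_splits)
    have w2: "w2 \<in> lists (letters G)" using Cons.prems(1) 2(1) by simp
    show ?thesis
    proof (cases m)
      case Nil
      then have s': "s = (q @ [f], tail G f, [])" using s by (auto split: if_splits)
      have "m' = [] \<and> (w2 \<noteq> [] \<longrightarrow> h' = h) \<and> (\<exists>t. p = [] @ t \<and> q' = (q @ [f]) @ t)"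
        by (rule Cons.IH[of w2 "tail G f"]) (use w2 2 s s' in auto)
      moreover have "w2 = [] \<Longrightarrow> h' = h" using 2 s s' by auto
      ultimately show ?thesis using Nil by auto
    next
      case m: (Cons g m1)
      then have s': "s = (q, k, m1)" "g = f" using s by (auto split: if_splits)
      have IH: "m' = [] \<and> (w2 \<noteq> [] \<longrightarrow> h' = h) \<and> (\<exists>t. p = m1 @ t \<and> q' = q @ t)"
        by (rule Cons.IH[of w2 "tail G f"]) (use w2 2 s s' m Cons.prems in auto)
      have "w2 = [] \<Longrightarrow> h' = h"
        using 2 s s' IH m by (auto split: if_splits)
      then show ?thesis using IH s' m by auto
    qed
  qed auto
qed

subsection \<open>Unitarity and purity\<close>

lemma Nil_closed [simp]: "[] \<in> closed_words G v"
  by (simp add: closed_words_def)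

lemma Nil_rising [simp]: "[] \<in> rising_words G v"
  by (simp add: rising_words_def)

lemma closed_append: "u \<in> closed_words G v \<Longrightarrow> w \<in> closed_words G v \<Longrightarrow> u @ w \<in> closed_words G v"
  by (auto simp: closed_words_def run_append)

lemma run_rising_append:
  assumes "run G u ([], v, []) = Some (p, v, [])"
  shows "run G (u @ w) ([], v, []) = map_option (\<lambda>(p', s). (p @ p', s)) (run G w ([], v, []))"
  using assms run_prefix'[of G w p v "[]"] by (simp add: run_append)

lemma rising_append: "u \<in> rising_words G v \<Longrightarrow> w \<in> rising_words G v \<Longrightarrow> u @ w \<in> rising_words G v"
  by (auto simp: rising_words_def run_rising_append)

lemma closed_left_unitary: "u \<in> closed_words G v \<Longrightarrow> u @ w \<in> closed_words G v \<Longrightarrow> w \<in> closed_words G v"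
  by (auto simp: closed_words_def run_append)

lemma rising_left_unitary: "u \<in> rising_words G v \<Longrightarrow> u @ w \<in> rising_words G v \<Longrightarrow> w \<in> rising_words G v"
  by (auto simp: rising_words_def run_rising_append)

text \<open>
  The plus part cannot shrink, so a rising prefix of a closed word has an empty one.
\<close>

lemma rising_prefix_closed: "u @ w \<in> closed_words G v \<Longrightarrow> u \<in> rising_words G v \<Longrightarrow> u \<in> closed_words G v"
  by (auto simp: rising_words_def closed_words_def elim: run_prefix_Nil)

text \<open>
  If \<open>x\<close> left letters on the stack when read from \<open>v\<close>, they would still be there after reading
  \<open>y x\<close>, which ends with the empty stack.  The final vertex depends on the last letter alone.
\<close>

lemma rising_very_pure:
  assumes "x @ y \<in> rising_words G v" "y @ x \<in> rising_words G v"
  shows "x \<in> rising_words G v"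
proof (cases "x = []")
  case False
  obtain p where p: "run G (x @ y) ([], v, []) = Some (p, v, [])" using assms by (auto simp: rising_words_def)
  obtain p' where p': "run G (y @ x) ([], v, []) = Some (p', v, [])" using assms by (auto simp: rising_words_def)
  obtain q h m where 1: "run G x ([], v, []) = Some (q, h, m)" using p by (auto simp: run_append split: bind_splits)
  obtain q2 h2 m2 where 2: "run G y ([], v, []) = Some (q2, h2, m2)" "run G x (q2, h2, m2) = Some (p', v, [])"
    using p' by (auto simp: run_append split: bind_splits)
  have "m = []" using run_stack_prefix[OF 1 2(2)] by auto
  moreover have "h = v" using run_tgt[OF False 1] run_tgt[OF False 2(2)] calculation by auto
  ultimately show ?thesis using 1 assms by (auto simp: rising_words_def)
qed simp

lemma closed_very_pure: "x @ y \<in> closed_words G v \<Longrightarrow> y @ x \<in> closed_words G v \<Longrightarrow> x \<in> closed_words G v"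
  using rising_very_pure[of x y G v] rising_prefix_closed[of x y G v] closed_subset_rising[of G v] by blast

section \<open>Circular codes and their generating functions\<close>

definition primes :: "'l list set \<Rightarrow> 'l list set" where
  "primes M = {w \<in> M. w \<noteq> [] \<and> (\<forall>j. 1 \<le> j \<and> j < length w \<longrightarrow> take j w \<notin> M)}"

definition conjugates :: "'l list set \<Rightarrow> nat \<Rightarrow> 'l list set" where
  "conjugates M n = {y @ x |x y. x @ y \<in> M \<and> length (x @ y) = n}"

lemma primes_subset: "primes M \<subseteq> M"
  by (auto simp: primes_def)

lemma primes_prefix: "u @ s \<in> primes M \<Longrightarrow> u \<in> M \<Longrightarrow> u = [] \<or> s = []"
  unfolding primes_def by (cases u; cases s) (auto dest!: spec[of _ "length u"])

lemma gen_fun_nth: "gen_fun C $ n = of_nat (card {w \<in> C. length w = n})"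
  by (simp add: gen_fun_def)

lemma gen_fun_primes_0: "gen_fun (primes M) $ 0 = 0"
proof -
  have "{w \<in> primes M. length w = 0} = {}" by (auto simp: primes_def)
  then show ?thesis by (simp only: gen_fun_nth card.empty of_nat_0)
qed

text \<open>
  Left unitarity makes the primes a prefix code, very purity makes them a circular code: a word
  written on a circle has at most one factorization into primes.
\<close>

locale pure_submonoid =
  fixes A :: "'l set" and M :: "'l list set"
  assumes finite_alphabet: "finite A"
    and words: "M \<subseteq> lists A"
    and Nil_in: "[] \<in> M"
    and append_in: "u \<in> M \<Longrightarrow> w \<in> M \<Longrightarrow> u @ w \<in> M"
    and left_unitary: "u \<in> M \<Longrightarrow> u @ w \<in> M \<Longrightarrow> w \<in> M"
    and very_pure: "x @ y \<in> M \<Longrightarrow> y @ x \<in> M \<Longrightarrow> x \<in> M"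
begin

lemma prime_in: "c \<in> primes M \<Longrightarrow> c \<in> M"
  by (simp add: primes_def)

lemma prime_ne: "c \<in> primes M \<Longrightarrow> c \<noteq> []"
  by (simp add: primes_def)

lemma factor_prime:
  assumes "w \<in> M" "w \<noteq> []"
  obtains c v where "c \<in> primes M" "v \<in> M" "w = c @ v"
proof -
  define j where "j = (LEAST j. 1 \<le> j \<and> take j w \<in> M)"
  have ex: "1 \<le> length w \<and> take (length w) w \<in> M" using assms by (cases w) auto
  have j: "1 \<le> j \<and> take j w \<in> M" unfolding j_def by (rule LeastI) (rule ex)
  have min: "\<And>i. 1 \<le> i \<Longrightarrow> i < j \<Longrightarrow> take i w \<notin> M" unfolding j_def using not_less_Least by blast
  have "take j w \<in> primes M" using j min assms(2) by (auto simp: primes_def)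
  moreover have "drop j w \<in> M" using left_unitary[of "take j w" "drop j w"] j assms by simp
  ultimately show ?thesis using that[of "take j w" "drop j w"] by simp
qed

lemma factor_unique:
  assumes "c \<in> primes M" "c' \<in> primes M" "c @ v = c' @ v'"
  shows "c = c' \<and> v = v'"
proof -
  obtain us where "c = c' @ us \<and> us @ v = v' \<or> c @ us = c' \<and> v = us @ v'"
    using assms(3) by (auto simp: append_eq_append_conv2)
  then show ?thesis
    using primes_prefix[of c' us] primes_prefix[of c us] prime_in prime_ne assms by auto
qed

text \<open>
  Two factorizations of the same circular word, each cut inside its first code word.  If the two
  cuts differ, the letters \<open>x\<close> between them are in \<open>M\<close> by very purity, so that
  \<open>x\<close> would be a proper prefix in \<open>M\<close> of a prime word.
\<close>

lemma cyclic_unique_le: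
  assumes c: "c \<in> primes M" "c' \<in> primes M" and v: "v \<in> M" "v' \<in> M" and k: "k < length c" "k' < length c'"
    and eq: "drop k c @ v @ take k c = drop k' c' @ v' @ take k' c'" and le: "k \<le> k'"
  shows "k = k' \<and> c = c' \<and> v = v'"
proof -
  obtain x where x: "take k' c' = x @ take k c"
  proof -
    have "(drop k c @ v) @ take k c = (drop k' c' @ v') @ take k' c'" using eq by simp
    then consider us where "us @ take k c = take k' c'" | us where "take k c = us @ take k' c'"
      unfolding append_eq_append_conv2 by metis
    then show ?thesis
    proof cases
      case (2 us)
      then have "k = length us + k'" using k by (metis length_append length_take min.absorb4)
      with le 2 show ?thesis using that[of "[]"] by simp
    qed (use that in metis)
  qed
  have eq': "drop k c @ v = drop k' c' @ v' @ x" using eq x by simp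
  let ?y = "take k c @ drop k' c' @ v'"
  have xc: "c' = x @ take k c @ drop k' c'" using x by (metis append_assoc append_take_drop_id)
  have "x @ ?y = c' @ v'" using xc by (metis append_assoc)
  moreover have "?y @ x = c @ v" using eq' by (metis append_assoc append_take_drop_id)
  ultimately have "x \<in> M" using very_pure[of x ?y] append_in prime_in c v by metis
  moreover have "drop k' c' \<noteq> []" using k by simp
  ultimately have "x = []" using primes_prefix[of x "take k c @ drop k' c'"] xc c by auto
  then have "k = k'" using x k le by (metis append_Nil length_take min.absorb4 nat_less_le)
  moreover have "c @ v = c' @ v'"
    using \<open>x = []\<close> \<open>x @ ?y = c' @ v'\<close> \<open>?y @ x = c @ v\<close> by (metis append_Nil append_Nil2)
  ultimately show ?thesis using factor_unique c by blast
qed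

lemma cyclic_unique:
  assumes "c \<in> primes M" "c' \<in> primes M" "v \<in> M" "v' \<in> M" "k < length c" "k' < length c'"
    and "drop k c @ v @ take k c = drop k' c' @ v' @ take k' c'"
  shows "k = k' \<and> c = c' \<and> v = v'"
  using cyclic_unique_le[of c c' v v' k k'] cyclic_unique_le[of c' c v' v k' k] assms
  by (metis nat_le_linear)

text \<open>
  Rotating by whole code words moves the cut into the first code word.
\<close>

lemma cyclic_factor:
  assumes "x @ y \<in> M" "x @ y \<noteq> []"
  shows "\<exists>c\<in>primes M. \<exists>v\<in>M. \<exists>k<length c. y @ x = drop k c @ v @ take k c"
  using assms
proof (induction "length x" arbitrary: x y rule: less_induct)
  case less
  obtain c v where cv: "c \<in> primes M" "v \<in> M" "x @ y = c @ v" using factor_prime less.prems by metis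
  show ?case
  proof (cases "length x < length c")
    case True
    obtain us where "x = c @ us \<and> us @ y = v \<or> x @ us = c \<and> y = us @ v"
      using cv(3) unfolding append_eq_append_conv2 by blast
    with True have us: "c = x @ us" "y = us @ v" by auto
    have "y @ x = drop (length x) c @ v @ take (length x) c" by (simp add: us)
    then show ?thesis using cv True by blast
  next
    case False
    obtain us where "x = c @ us \<and> us @ y = v \<or> x @ us = c \<and> y = us @ v"
      using cv(3) unfolding append_eq_append_conv2 by blast
    with False obtain x' where x': "x = c @ x'" "v = x' @ y"
      by (cases "us = []") auto
    have "x' @ (y @ c) \<in> M" using append_in[OF cv(2) prime_in[OF cv(1)]] x' by simp
    then have "\<exists>c'\<in>primes M. \<exists>v\<in>M. \<exists>k<length c'. (y @ c) @ x' = drop k c' @ v @ take k c'"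
      using prime_ne[OF cv(1)] x' by (intro less.hyps) auto
    then show ?thesis using x' by simp
  qed
qed

lemma finite_level [simp]: "finite {w \<in> S. length w = n}" if "S \<subseteq> lists A" for S
proof -
  have "finite {w. set w \<subseteq> A \<and> length w = n}" using finite_alphabet finite_lists_length_eq by blast
  then show ?thesis by (rule rev_finite_subset) (use that in auto)
qed

lemma primes_words: "primes M \<subseteq> lists A"
  using prime_in words by blast

lemma card_level:
  assumes "n > 0"
  shows "card {w \<in> M. length w = n} =
    (\<Sum>k=0..n. card {c \<in> primes M. length c = k} * card {v \<in> M. length v = n - k})"
proof -
  let ?S = "Sigma {0..n} (\<lambda>k. {c \<in> primes M. length c = k} \<times> {v \<in> M. length v = n - k})"
  have "bij_betw (\<lambda>(k, c, v). c @ v) ?S {w \<in> M. length w = n}"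
  proof (rule bij_betwI')
    fix s t assume st: "s \<in> ?S" "t \<in> ?S"
    obtain k c v k' c' v' where eq: "s = (k, c, v)" "t = (k', c', v')" by (cases s; cases t)
    show "((case s of (k, c, v) \<Rightarrow> c @ v) = (case t of (k, c, v) \<Rightarrow> c @ v)) = (s = t)"
      using factor_unique[of c c' v v'] st unfolding eq by auto
  next
    fix s assume "s \<in> ?S"
    then show "(case s of (k, c, v) \<Rightarrow> c @ v) \<in> {w \<in> M. length w = n}"
      using append_in prime_in by auto
  next
    fix w assume w: "w \<in> {w \<in> M. length w = n}"
    then obtain c v where cv: "c \<in> primes M" "v \<in> M" "w = c @ v" using factor_prime[of w] assms by auto
    then show "\<exists>s\<in>?S. w = (case s of (k, c, v) \<Rightarrow> c @ v)"
      using w by (intro bexI[of _ "(length c, c, v)"]) auto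
  qed
  then have "card {w \<in> M. length w = n} = card ?S" by (rule bij_betw_same_card[symmetric])
  also have "\<dots> = (\<Sum>k=0..n. card {c \<in> primes M. length c = k} * card {v \<in> M. length v = n - k})"
    using words primes_words by (subst card_SigmaI) (auto simp: card_cartesian_product)
  finally show ?thesis .
qed

text \<open>
  A circular word with a marked letter is a choice of the code word \<open>c\<close> containing the mark, of one
  of the \<open>length c\<close> positions in it, and of a word of \<open>M\<close> for the rest of the circle.
\<close>

lemma card_conjugates:
  assumes "n > 0"
  shows "card (conjugates M n) =
    (\<Sum>k=0..n. k * card {c \<in> primes M. length c = k} * card {v \<in> M. length v = n - k})"
proof -
  let ?S = "Sigma {0..n} (\<lambda>k. {..<k} \<times> {c \<in> primes M. length c = k} \<times> {v \<in> M. length v = n - k})"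
  let ?f = "\<lambda>(k, i, c, v). drop i c @ v @ take i c"
  have "bij_betw ?f ?S (conjugates M n)"
  proof (rule bij_betwI')
    fix s t assume st: "s \<in> ?S" "t \<in> ?S"
    obtain k i c v k' i' c' v' where eq: "s = (k, i, c, v)" "t = (k', i', c', v')" by (cases s; cases t)
    show "(?f s = ?f t) = (s = t)"
      using cyclic_unique[of c c' v v' i i'] st unfolding eq by auto
  next
    fix s assume s: "s \<in> ?S"
    obtain k i c v where s': "s = (k, i, c, v)" by (cases s)
    have "take i c @ drop i c @ v \<in> M" using s s' append_in[OF prime_in[of c], of v] by (simp flip: append_assoc)
    moreover have "length (take i c @ drop i c @ v) = n" using s s' by auto
    moreover have "?f s = (drop i c @ v) @ take i c" using s' by simp
    ultimately show "?f s \<in> conjugates M n"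
      unfolding conjugates_def by blast
  next
    fix w assume "w \<in> conjugates M n"
    then obtain x y where xy: "w = y @ x" "x @ y \<in> M" "length (x @ y) = n" by (auto simp: conjugates_def)
    then obtain c v k where cv: "c \<in> primes M" "v \<in> M" "k < length c" "w = drop k c @ v @ take k c"
      using cyclic_factor[of x y] assms by fastforce
    have "length w = length c + length v" using cv(3) unfolding cv(4) by simp
    with xy have "length c + length v = n" by simp
    then show "\<exists>s\<in>?S. w = ?f s"
      using cv by (intro bexI[of _ "(length c, k, c, v)"]) auto
  qed
  then have "card (conjugates M n) = card ?S" by (rule bij_betw_same_card[symmetric])
  also have "\<dots> = (\<Sum>k=0..n. k * card {c \<in> primes M. length c = k} * card {v \<in> M. length v = n - k})"
    using words primes_words by (subst card_SigmaI) (auto simp: card_cartesian_product mult.assoc)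
  finally show ?thesis .
qed

lemma finite_conjugates: "finite (conjugates M n)"
proof -
  have "finite {w. set w \<subseteq> A \<and> length w = n}" using finite_alphabet finite_lists_length_eq by blast
  moreover have "conjugates M n \<subseteq> {w. set w \<subseteq> A \<and> length w = n}"
    using words by (fastforce simp: conjugates_def)
  ultimately show ?thesis by (rule rev_finite_subset)
qed

lemma level_0: "{v \<in> M. length v = 0} = {[]}" "{c \<in> primes M. length c = 0} = {}"
  using Nil_in prime_ne by auto

lemma gen_fun_submonoid: "gen_fun M * (1 - gen_fun (primes M)) = 1"
proof -
  have "gen_fun M = 1 + gen_fun (primes M) * gen_fun M"
  proof (rule fps_ext)
    fix n
    show "gen_fun M $ n = (1 + gen_fun (primes M) * gen_fun M) $ n"
    proof (cases "n = 0")
      case True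
      then show ?thesis using level_0 by (simp add: gen_fun_def fps_mult_nth)
    next
      case False
      then show ?thesis by (simp add: gen_fun_def fps_mult_nth card_level)
    qed
  qed
  then show ?thesis by (simp add: algebra_simps)
qed

text \<open>
  Read as a formula for the first factor, this is \<open>z f' / f\<close> for \<open>f = 1 / (1 - g)\<close>.  The
  conjugates of length \<open>0\<close> are left out because periods are positive.
\<close>

lemma conjugates_fps:
  "Abs_fps (\<lambda>n. if n = 0 then 0 else of_nat (card (conjugates M n)) :: complex) * (1 - gen_fun (primes M))
   = fps_X * fps_deriv (gen_fun (primes M))"
  (is "?L * (1 - ?g) = _")
proof -
  have d: "(fps_X * fps_deriv ?g) $ k = of_nat k * ?g $ k" for k
    by (cases k) auto
  have "?L = fps_X * fps_deriv ?g * gen_fun M"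
  proof (rule fps_ext)
    fix n
    show "?L $ n = (fps_X * fps_deriv ?g * gen_fun M) $ n"
      by (cases "n = 0") (simp_all add: fps_mult_nth[of "fps_X * fps_deriv ?g"] d gen_fun_nth card_conjugates
          del: fps_X_mult_nth)
  qed
  then show ?thesis using gen_fun_submonoid by (simp add: mult.assoc)
qed

end

subsection \<open>Arithmetic of generating functions\<close>

lemma gen_fun_Un:
  assumes "finite A" "S \<subseteq> lists A" "T \<subseteq> lists A" "S \<inter> T = {}"
  shows "gen_fun (S \<union> T) = gen_fun S + gen_fun T"
proof (rule fps_ext)
  fix n
  have fin: "finite {w \<in> S. length w = n}" if "S \<subseteq> lists A" for S
    using finite_lists_length_eq[OF assms(1), of n] by (rule rev_finite_subset) (use that in auto)
  have "{w \<in> S \<union> T. length w = n} = {w \<in> S. length w = n} \<union> {w \<in> T. length w = n}" by auto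
  then have "card {w \<in> S \<union> T. length w = n} = card {w \<in> S. length w = n} + card {w \<in> T. length w = n}"
    using assms fin by (simp, subst card_Un_disjoint) auto
  then show "gen_fun (S \<union> T) $ n = (gen_fun S + gen_fun T) $ n" by (simp add: gen_fun_def)
qed

lemma gen_fun_image:
  assumes inj: "inj_on f (I \<times> S)" and len: "\<And>i w. i \<in> I \<Longrightarrow> w \<in> S \<Longrightarrow> length (f (i, w)) = length w + k"
  shows "gen_fun (f ` (I \<times> S)) = of_nat (card I) * fps_X ^ k * gen_fun S"
proof (rule fps_ext)
  fix n
  show "gen_fun (f ` (I \<times> S)) $ n = (of_nat (card I) * fps_X ^ k * gen_fun S) $ n"
  proof (cases "n < k")
    case True
    then have "{w \<in> f ` (I \<times> S). length w = n} = {}" using len by auto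
    then have "card {w \<in> f ` (I \<times> S). length w = n} = 0" by (simp only: card.empty)
    then show ?thesis using True by (simp add: gen_fun_def mult.assoc fps_X_power_mult_nth)
  next
    case False
    then have "{w \<in> f ` (I \<times> S). length w = n} = f ` (I \<times> {w \<in> S. length w = n - k})"
      using len by auto
    moreover have "card (f ` (I \<times> {w \<in> S. length w = n - k})) = card (I \<times> {w \<in> S. length w = n - k})"
      by (intro card_image inj_on_subset[OF inj]) auto
    ultimately have "card {w \<in> f ` (I \<times> S). length w = n} = card I * card {w \<in> S. length w = n - k}"
      by (simp only: card_cartesian_product)
    then show ?thesis using False by (simp add: gen_fun_def mult.assoc fps_X_power_mult_nth)
  qed
qed

lemma gen_fun_Nil: "gen_fun {[]} = 1"
proof (rule fps_ext)
  fix n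
  have "{w \<in> {[]}. length w = n} = (if n = 0 then {[]} else {})" by auto
  then show "gen_fun {[]} $ n = 1 $ n" by (simp add: gen_fun_def)
qed

section \<open>Prime closed words and prime rising words\<close>

lemma finite_letters: "finite (arcs G) \<Longrightarrow> finite (letters G)"
  by (simp add: letters_def)

lemma pure_submonoid_closed: "finite (arcs G) \<Longrightarrow> pure_submonoid (letters G) (closed_words G v)"
  by unfold_locales
    (auto simp: finite_letters closed_append dest: closed_left_unitary closed_very_pure, auto simp: closed_words_def)

lemma pure_submonoid_rising: "finite (arcs G) \<Longrightarrow> pure_submonoid (letters G) (rising_words G v)"
  by unfold_locales
    (auto simp: finite_letters rising_append dest: rising_left_unitary rising_very_pure, auto simp: rising_words_def)

lemma closed_words_lists: "closed_words G v \<subseteq> lists (letters G)"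
  by (auto simp: closed_words_def)

lemma rising_words_lists: "rising_words G v \<subseteq> lists (letters G)"
  by (auto simp: rising_words_def)

lemma primesI:
  assumes "w \<in> M" "w \<noteq> []" "\<And>u s. w = u @ s \<Longrightarrow> u \<in> M \<Longrightarrow> u = [] \<or> s = []"
  shows "w \<in> primes M"
proof -
  have "take j w \<notin> M" if "1 \<le> j" "j < length w" for j
    using assms(3)[of "take j w" "drop j w"] that by auto
  with assms show ?thesis by (auto simp: primes_def)
qed

lemma wrap_closed:
  assumes "e \<in> arcs G" "d \<in> closed_words G (head G e)"
  shows "Minus e # d @ [Plus e] \<in> closed_words G (tail G e)"
proof -
  have "run G d ([], tail G e, [e]) = Some ([], tail G e, [e])"
    using run_on_stack[of G d "head G e" "head G e" "[]" "tail G e" "[e]" "[]"] assms by (simp add: closed_words_def)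
  then show ?thesis using assms by (simp add: closed_words_def run_append)
qed

text \<open>
  Only the last letter of a prime closed word can cancel the first one.
\<close>

lemma prime_closed_iff:
  "w \<in> primes (closed_words G v) \<longleftrightarrow>
    (\<exists>e\<in>arcs G. tail G e = v \<and> (\<exists>d\<in>closed_words G (head G e). w = Minus e # d @ [Plus e]))"
proof
  assume w: "w \<in> primes (closed_words G v)"
  then have cl: "w \<in> lists (letters G)" "run G w ([], v, []) = Some ([], v, [])" "w \<noteq> []"
    by (auto simp: primes_def closed_words_def)
  obtain w0 x where w0: "w = w0 @ [x]" using cl(3) by (metis rev_exhaust)
  obtain m where m: "run G w0 ([], v, []) = Some ([], v, m)" "run G [x] ([], v, m) = Some ([], v, [])"
    using cl(2) unfolding w0 by (elim run_prefix_Nil)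
  have "x \<in> letters G" using cl w0 by auto
  then obtain e where x: "x = Plus e" "e \<in> arcs G" "m = [e]"
    using m(2) by (cases x; cases m) (auto simp: letters_def split: if_splits)
  have "w0 \<in> lists (letters G)" using cl w0 by auto
  from this m(1) show "\<exists>e\<in>arcs G. tail G e = v \<and> (\<exists>d\<in>closed_words G (head G e). w = Minus e # d @ [Plus e])"
  proof (cases rule: run_cases)
    case (minus d e' w2 m')
    then have d: "d = []" using primes_prefix[of d "Minus e' # w2 @ [x]" "closed_words G v"] w w0 by auto
    have "w2 \<in> closed_words G (head G e)" using minus cl w0 x by (auto simp: closed_words_def)
    then show ?thesis using minus x w0 d by auto
  qed (use x in auto)
next
  assume "\<exists>e\<in>arcs G. tail G e = v \<and> (\<exists>d\<in>closed_words G (head G e). w = Minus e # d @ [Plus e])"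
  then obtain e d where e: "e \<in> arcs G" "tail G e = v" and d: "d \<in> closed_words G (head G e)"
    and w: "w = Minus e # d @ [Plus e]" by blast
  show "w \<in> primes (closed_words G v)"
  proof (rule primesI)
    show "w \<in> closed_words G v" using wrap_closed e d w by auto
    fix u s assume us: "w = u @ s" "u \<in> closed_words G v"
    show "u = [] \<or> s = []"
    proof (rule ccontr)
      assume ne: "\<not> ?thesis"
      then obtain u' where u': "u = Minus e # u'" using us w by (cases u) auto
      obtain s' where s': "d = u' @ s'" using us ne u' w by (cases s rule: rev_cases) auto
      obtain m where "run G u' ([], head G e, []) = Some ([], head G e, m)"
        using d unfolding s' closed_words_def by (auto elim: run_prefix_Nil)
      then have "run G u' ([], v, [e]) = Some ([], v, m @ [e])"
        using run_on_stack[of G u' "head G e" "head G e" m v "[e]" "[]"] by simp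
      then show False using us u' e by (auto simp: closed_words_def)
    qed
  qed (simp add: w)
qed

lemma prime_closed_in_primes_rising:
  assumes "w \<in> primes (closed_words G v)"
  shows "w \<in> primes (rising_words G v)"
proof (rule primesI)
  show "w \<in> rising_words G v" "w \<noteq> []" using assms closed_subset_rising[of G v] by (auto simp: primes_def)
  fix u s assume "w = u @ s" "u \<in> rising_words G v"
  then show "u = [] \<or> s = []"
    using assms rising_prefix_closed[of u s G v] primes_prefix[of u s "closed_words G v"] by (auto simp: primes_def)
qed

lemma rising_not_closed:
  assumes "w \<in> rising_words G v" "w \<notin> closed_words G v"
  obtains d f w2 where "w = d @ Plus f # w2" "d \<in> closed_words G v" "f \<in> arcs G" "head G f = v"
    "\<exists>p. run G w2 ([], tail G f, []) = Some (p, v, [])"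
proof -
  obtain p where p: "w \<in> lists (letters G)" "run G w ([], v, []) = Some (p, v, [])"
    using assms(1) by (auto simp: rising_words_def)
  then show ?thesis
  proof (cases rule: run_cases)
    case (plus d f w2 p')
    then show ?thesis using that p by auto
  qed (use assms in auto)
qed

text \<open>
  A prime rising word that is not closed starts with an uncancelled plus letter.  If this letter leads
  to \<open>y\<close>, the next uncancelled plus letter leads back to \<open>x\<close>, as there is no loop at \<open>y\<close>, and the
  word ends there.
\<close>

lemma prime_rising_iff:
  assumes wf: "wf_digraph G" and V: "verts G = {x, y}" "x \<noteq> y" and no_loop: "\<And>e. e \<in> arcs G \<Longrightarrow> tail G e = y \<Longrightarrow> head G e \<noteq> y"
  shows "w \<in> primes (rising_words G x) \<longleftrightarrow>
    w \<in> primes (closed_words G x) \<or>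
    (\<exists>e\<in>arcs G. tail G e = x \<and> head G e = x \<and> w = [Plus e]) \<or>
    (\<exists>e\<in>arcs G. tail G e = y \<and> head G e = x \<and> (\<exists>f\<in>arcs G. tail G f = x \<and> head G f = y \<and>
       (\<exists>d\<in>closed_words G y. w = Plus e # d @ [Plus f])))"
    (is "_ \<longleftrightarrow> _ \<or> ?A \<or> ?B")
proof
  assume w: "w \<in> primes (rising_words G x)"
  show "w \<in> primes (closed_words G x) \<or> ?A \<or> ?B"
  proof (cases "w \<in> closed_words G x")
    case True
    then have "w \<in> primes (closed_words G x)"
      using w closed_subset_rising[of G x] by (auto simp: primes_def)
    then show ?thesis ..
  next
    case False
    have "w \<in> rising_words G x" using w by (simp add: primes_def)
    then obtain d e w2 p where 1: "w = d @ Plus e # w2" "d \<in> closed_words G x" "e \<in> arcs G" "head G e = x"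
      "run G w2 ([], tail G e, []) = Some (p, x, [])"
      using rising_not_closed False by metis
    have d: "d = []" using primes_prefix[of d "Plus e # w2"] w 1 closed_subset_rising[of G x] by auto
    show ?thesis
    proof (cases "tail G e = x")
      case True
      then have "[Plus e] \<in> rising_words G x" using 1 by (simp add: rising_words_def)
      then have "w2 = []" using primes_prefix[of "[Plus e]" w2] w 1 d by auto
      then show ?thesis using True 1 d by auto
    next
      case False
      then have t: "tail G e = y" using 1 wf V wf_digraph.tail_in_verts by fastforce
      have "w2 \<in> lists (letters G)" using w 1 by (auto simp: primes_def rising_words_def)
      from this 1(5) show ?thesis unfolding t
      proof (cases rule: run_cases)
        case (plus d' f w3 p')
        have f: "f \<in> arcs G" using plus w 1 by (auto simp: primes_def rising_words_def)
        have tf: "tail G f = x" using no_loop[of f] f plus wf V wf_digraph.tail_in_verts by fastforce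
        have "run G d' ([e], y, []) = Some ([e], y, [])"
          using run_prefix'[of G d' "[e]" y "[]"] plus by (simp add: closed_words_def)
        then have "Plus e # d' @ [Plus f] \<in> rising_words G x"
          using 1 plus f tf t by (auto simp: rising_words_def closed_words_def run_append)
        then have "w3 = []" using primes_prefix[of "Plus e # d' @ [Plus f]" w3] w 1 d plus by auto
        then have "?B" using 1 d plus f tf t by auto
        then show ?thesis by blast
      qed (use V in auto)
    qed
  qed
next
  assume "w \<in> primes (closed_words G x) \<or> ?A \<or> ?B"
  then consider "w \<in> primes (closed_words G x)" | ?A | ?B by blast
  then show "w \<in> primes (rising_words G x)"
  proof cases
    case 1
    then show ?thesis by (rule prime_closed_in_primes_rising)
  next
    case 2
    then obtain e where e: "e \<in> arcs G" "tail G e = x" "head G e = x" "w = [Plus e]" by blast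
    show ?thesis by (rule primesI) (use e in \<open>auto simp: rising_words_def append_eq_Cons_conv Cons_eq_append_conv\<close>)
  next
    case 3
    then obtain e f d where e: "e \<in> arcs G" "tail G e = y" "head G e = x"
      and f: "f \<in> arcs G" "tail G f = x" "head G f = y" and d: "d \<in> closed_words G y"
      and w: "w = Plus e # d @ [Plus f]" by blast
    show ?thesis
    proof (rule primesI)
      have "run G d ([e], y, []) = Some ([e], y, [])"
        using run_prefix'[of G d "[e]" y "[]"] d by (simp add: closed_words_def)
      then show "w \<in> rising_words G x" using e f d w by (auto simp: rising_words_def closed_words_def run_append)
      fix u s assume us: "w = u @ s" "u \<in> rising_words G x"
      show "u = [] \<or> s = []"
      proof (rule ccontr)
        assume ne: "\<not> ?thesis"
        then obtain u' where u': "u = Plus e # u'" using us w by (cases u) auto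
        obtain s' where s': "d = u' @ s'" using us ne u' w by (cases s rule: rev_cases) auto
        obtain m where "run G u' ([], y, []) = Some ([], y, m)"
          using d unfolding s' closed_words_def by (auto elim: run_prefix_Nil)
        then have "run G u ([], x, []) = Some ([e], y, m)"
          using run_prefix'[of G u' "[e]" y "[]"] e u' by simp
        then show False using us V by (auto simp: rising_words_def)
      qed
    qed (simp add: w)
  qed
qed

text \<open>
  The code words \<open>e\<^sup>- d e\<^sup>+\<close> are counted by the arc \<open>e\<close> and the closed word \<open>d\<close>; the two outer
  letters account for \<open>z\<^sup>2\<close>.
\<close>

lemma gen_fun_primes_closed:
  assumes "fin_digraph G" and V: "verts G = {x, y}" "x \<noteq> y"
  shows "gen_fun (primes (closed_words G v)) =
    fps_X ^ 2 * (of_nat (adjacency G v x) * gen_fun (closed_words G x) + of_nat (adjacency G v y) * gen_fun (closed_words G y))"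
proof -
  interpret fin_digraph G by fact
  let ?f = "\<lambda>(e, d). Minus e # d @ [Plus e] :: ('a, 'b) gen list"
  let ?E = "\<lambda>z. {e \<in> arcs G. tail G e = v \<and> head G e = z}"
  have eq: "primes (closed_words G v) = ?f ` (?E x \<times> closed_words G x) \<union> ?f ` (?E y \<times> closed_words G y)"
  proof (intro set_eqI iffI)
    fix w assume "w \<in> primes (closed_words G v)"
    then obtain e d where ed: "e \<in> arcs G" "tail G e = v" "d \<in> closed_words G (head G e)" "w = Minus e # d @ [Plus e]"
      unfolding prime_closed_iff by blast
    have w: "w \<in> ?f ` (?E (head G e) \<times> closed_words G (head G e))"
      by (rule image_eqI[of w ?f "(e, d)"]) (use ed in auto)
    have "head G e = x \<or> head G e = y" using head_in_verts[OF ed(1)] V by auto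
    with w show "w \<in> ?f ` (?E x \<times> closed_words G x) \<union> ?f ` (?E y \<times> closed_words G y)"
      by (elim disjE) simp_all
  next
    fix w assume "w \<in> ?f ` (?E x \<times> closed_words G x) \<union> ?f ` (?E y \<times> closed_words G y)"
    then show "w \<in> primes (closed_words G v)"
      unfolding prime_closed_iff by auto
  qed
  have img: "gen_fun (?f ` (?E z \<times> closed_words G z)) = of_nat (adjacency G v z) * fps_X ^ 2 * gen_fun (closed_words G z)" for z
    unfolding adjacency_def by (rule gen_fun_image) (auto simp: inj_on_def)
  define S where "S z = ?f ` (?E z \<times> closed_words G z)" for z
  have "S x \<union> S y \<subseteq> lists (letters G)"
    using primes_subset[of "closed_words G v"] closed_words_lists[of G v] unfolding eq S_def by (rule subset_trans)
  moreover have "z = z'" if "w \<in> S z" "w \<in> S z'" for w z z'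
    using that unfolding S_def by clarsimp
  ultimately have "gen_fun (S x \<union> S y) = gen_fun (S x) + gen_fun (S y)"
    using V(2) by (intro gen_fun_Un[OF finite_letters[OF finite_arcs]]) blast+
  then show ?thesis unfolding eq S_def img by (simp add: algebra_simps)
qed

lemma gen_fun_primes_rising:
  assumes "fin_digraph G" and V: "verts G = {x, y}" "x \<noteq> y" and no_loop: "adjacency G y y = 0"
  shows "gen_fun (primes (rising_words G x)) = gen_fun (primes (closed_words G x)) + of_nat (adjacency G x x) * fps_X
     + of_nat (adjacency G x y * adjacency G y x) * fps_X ^ 2 * gen_fun (closed_words G y)"
proof -
  interpret fin_digraph G by fact
  let ?f = "\<lambda>(e, d). Plus e # d :: ('a, 'b) gen list"
  let ?g = "\<lambda>((f, e), d). Plus e # d @ [Plus f] :: ('a, 'b) gen list"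
  let ?E = "\<lambda>u v. {e \<in> arcs G. tail G e = u \<and> head G e = v}"
  define S where "S = ?f ` (?E x x \<times> {[]})"
  define T where "T = ?g ` ((?E x y \<times> ?E y x) \<times> closed_words G y)"
  define P where "P = primes (closed_words G x)"
  have S_iff: "w \<in> S \<longleftrightarrow> (\<exists>e\<in>arcs G. tail G e = x \<and> head G e = x \<and> w = [Plus e])" for w
    unfolding S_def by auto
  have T_iff: "w \<in> T \<longleftrightarrow> (\<exists>e\<in>arcs G. tail G e = y \<and> head G e = x \<and> (\<exists>f\<in>arcs G. tail G f = x \<and> head G f = y \<and>
       (\<exists>d\<in>closed_words G y. w = Plus e # d @ [Plus f])))" (is "_ \<longleftrightarrow> ?B w") for w
  proof
    assume "?B w"
    then obtain e f d where "e \<in> ?E y x" "f \<in> ?E x y" "d \<in> closed_words G y" "w = Plus e # d @ [Plus f]" by blast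
    then show "w \<in> T" unfolding T_def by (intro image_eqI[of w ?g "((f, e), d)"]) auto
  qed (auto simp: T_def)
  have nl: "tail G e = y \<Longrightarrow> head G e \<noteq> y" if "e \<in> arcs G" for e
    using no_loop that unfolding adjacency_def by auto
  have eq: "primes (rising_words G x) = P \<union> (S \<union> T)"
  proof (rule set_eqI)
    fix w
    show "w \<in> primes (rising_words G x) \<longleftrightarrow> w \<in> P \<union> (S \<union> T)"
      unfolding Un_iff S_iff T_iff P_def by (rule prime_rising_iff[OF wf_digraph V]) (use nl in blast)
  qed
  have "P \<union> (S \<union> T) \<subseteq> lists (letters G)"
    using primes_subset[of "rising_words G x"] rising_words_lists[of G x] unfolding eq by (rule subset_trans)
  then have sub: "P \<subseteq> lists (letters G)" "S \<subseteq> lists (letters G)" "T \<subseteq> lists (letters G)" by simp_all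
  have "w \<notin> S \<and> w \<notin> T" if "w \<in> P" for w
    using that unfolding S_iff T_iff P_def prime_closed_iff by auto
  then have PST: "P \<inter> (S \<union> T) = {}" by blast
  have "w \<notin> T" if "w \<in> S" for w
    using that unfolding S_iff T_iff by auto
  then have ST: "S \<inter> T = {}" by blast
  note gU = gen_fun_Un[OF finite_letters[OF finite_arcs]]
  have sum: "gen_fun (P \<union> (S \<union> T)) = gen_fun P + (gen_fun S + gen_fun T)"
    using gU[OF sub(1) _ PST] gU[OF sub(2,3) ST] sub by simp
  have "gen_fun S = of_nat (adjacency G x x) * fps_X ^ 1 * gen_fun {[] :: ('a, 'b) gen list}"
    unfolding adjacency_def S_def by (rule gen_fun_image) (auto simp: inj_on_def)
  moreover have "gen_fun T = of_nat (card (?E x y \<times> ?E y x)) * fps_X ^ 2 * gen_fun (closed_words G y)"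
    unfolding T_def by (rule gen_fun_image) (auto simp: inj_on_def)
  ultimately show ?thesis
    unfolding eq sum by (simp add: P_def gen_fun_Nil card_cartesian_product adjacency_def add.assoc)
qed

section \<open>Periodic points\<close>

text \<open>
  One period of a periodic point of the shift.
\<close>

definition recurrent_words :: "('v, 'e) pre_digraph \<Rightarrow> nat \<Rightarrow> ('v, 'e) gen list set" where
  "recurrent_words G n =
    {w \<in> lists (letters G). length w = n \<and> (\<forall>k\<ge>1. nonzero G (concat (replicate k w)))}"

subsection \<open>Periodic points are determined by recurrent words\<close>

lemma shift_map_funpow: "(shift_map ^^ n) x = (\<lambda>i. x (i + int n))"
  by (induction n arbitrary: x) (auto simp: shift_map_def funpow_swap1 add_ac fun_eq_iff)

lemma periodic_mod:
  fixes x :: "int \<Rightarrow> 'l"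
  assumes "\<And>i. x (i + int n) = x i"
  shows "x (i mod int n) = x i"
proof -
  have "x (i + int (k * n)) = x i" for i k
  proof (induction k)
    case (Suc k)
    have "x (i + int (Suc k * n)) = x (i + int (k * n) + int n)" by (simp add: algebra_simps)
    with Suc assms show ?case by simp
  qed simp
  then have nat: "x (i + int k * int n) = x i" for i k by simp
  have all: "x (i + q * int n) = x i" for i q
  proof (cases "q \<ge> 0")
    case True
    then show ?thesis using nat[of i "nat q"] by simp
  next
    case False
    then show ?thesis using nat[of "i + q * int n" "nat (- q)"] by (simp add: algebra_simps)
  qed
  show ?thesis using all[of "i mod int n" "i div int n"] by (simp add: add.commute)
qed

lemma map_upto_upt: "map x [i..j] = map (\<lambda>k. x (i + int k)) [0..<nat (j - i + 1)]"
  by (rule nth_equalityI) (auto simp: nth_upto)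

lemma concat_replicate_periodic:
  assumes "\<And>i. x (i + int n) = x i"
  shows "concat (replicate k (map (\<lambda>i. x (int i)) [0..<n])) = map (\<lambda>i. x (int i)) [0..<k * n]"
proof (induction k)
  case (Suc k)
  have "[0..<Suc k * n] = [0..<n] @ map (\<lambda>i. i + n) [0..<k * n]"
    unfolding map_add_upt by (simp add: upt_add_eq_append[of 0 n "k * n", simplified] add.commute)
  then show ?case by (simp only: replicate_Suc concat.simps Suc.IH) (simp add: assms o_def)
qed simp

text \<open>
  Every window of a periodic sequence is a factor of a power of its period.
\<close>

lemma nonzero_windows_iff:
  assumes n: "n > 0" and per: "\<And>i. x (i + int n) = x i" and inL: "\<And>i. x i \<in> letters G"
  shows "(\<forall>i j. i \<le> j \<longrightarrow> nonzero G (map x [i..j])) \<longleftrightarrow>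
    (\<forall>k\<ge>1. nonzero G (concat (replicate k (map (\<lambda>i. x (int i)) [0..<n]))))"
proof (intro iffI allI impI)
  fix k :: nat assume *: "\<forall>i j. i \<le> j \<longrightarrow> nonzero G (map x [i..j])" "1 \<le> k"
  have "0 < k * n" using n *(2) by simp
  then have "(0::int) \<le> int (k * n) - 1" by linarith
  with * have "nonzero G (map x [0..int (k * n) - 1])" by blast
  then show "nonzero G (concat (replicate k (map (\<lambda>i. x (int i)) [0..<n])))"
    unfolding concat_replicate_periodic[of x n, OF per] map_upto_upt by (simp add: nat_mult_distrib)
next
  fix i j :: int
  assume *: "\<forall>k\<ge>1. nonzero G (concat (replicate k (map (\<lambda>i. x (int i)) [0..<n])))" and ij: "i \<le> j"
  define i' where "i' = nat (i mod int n)"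
  define l where "l = nat (j - i + 1)"
  have l: "l \<ge> 1" using ij by (simp add: l_def)
  have "x (i + int k) = x (int (k + i'))" for k
  proof -
    have "x (i + int k) = x ((i + int k) mod int n)" using periodic_mod[of x n, OF per] by simp
    also have "\<dots> = x ((int i' + int k) mod int n)" using n by (simp add: i'_def mod_simps)
    also have "\<dots> = x (int (k + i'))" using periodic_mod[of x n, OF per] by (simp add: add.commute)
    finally show ?thesis .
  qed
  then have w: "map x [i..j] = map (\<lambda>i. x (int i)) [i'..<i' + l]"
    unfolding map_upto_upt l_def[symmetric]
    by (simp add: add.commute[of i' l] flip: map_add_upt)
  have le: "i' + l \<le> (i' + l) * n" using n by simp
  have "[0..<(i' + l) * n] = [0..<i' + l] @ [i' + l..<(i' + l) * n]"
    using upt_add_eq_append[of 0 "i' + l" "(i' + l) * n - (i' + l)"] le by simp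
  moreover have "[0..<i' + l] = [0..<i'] @ [i'..<i' + l]"
    using upt_add_eq_append[of 0 i' l] by simp
  moreover have "nonzero G (map (\<lambda>i. x (int i)) [0..<(i' + l) * n])"
    using *[rule_format, of "i' + l"] l unfolding concat_replicate_periodic[of x n, OF per] by simp
  ultimately have "nonzero G (map (\<lambda>i. x (int i)) [0..<i'] @ map x [i..j] @ map (\<lambda>i. x (int i)) [i' + l..<(i' + l) * n])"
    unfolding w by simp
  then show "nonzero G (map x [i..j])"
    by (rule nonzero_factor) (use inL in auto)
qed

lemma num_periodic_markov_dyck:
  assumes n: "n > 0"
  shows "num_periodic (markov_dyck_shift G) n = card (recurrent_words G n)"
proof -
  let ?P = "{x \<in> markov_dyck_shift G. (shift_map ^^ n) x = x}"
  let ?f = "\<lambda>x. map (\<lambda>i. x (int i)) [0..<n]"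
  have P: "x \<in> ?P \<longleftrightarrow> (\<forall>i. x i \<in> letters G) \<and> (\<forall>i. x (i + int n) = x i) \<and>
      (\<forall>i j. i \<le> j \<longrightarrow> nonzero G (map x [i..j]))" for x
    by (auto simp: markov_dyck_shift_def nonzero_def shift_map_funpow fun_eq_iff)
  have R: "?f x \<in> recurrent_words G n \<longleftrightarrow> (\<forall>k\<ge>1. nonzero G (concat (replicate k (?f x))))"
    if "\<forall>i. x i \<in> letters G" for x
    using that by (auto simp: recurrent_words_def)
  have "bij_betw ?f ?P (recurrent_words G n)"
  proof (rule bij_betwI')
    fix x y assume x: "x \<in> ?P" and y: "y \<in> ?P"
    show "(?f x = ?f y) = (x = y)"
    proof
      assume eq: "?f x = ?f y"
      have "x i = y i" for i
      proof -
        let ?k = "nat (i mod int n)"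
        have k: "?k < n" "int ?k = i mod int n" using n by (auto simp: nat_less_iff)
        have "?f x ! ?k = ?f y ! ?k" by (simp only: eq)
        then have "x (i mod int n) = y (i mod int n)" using k by simp
        then show ?thesis using periodic_mod[of x n i] periodic_mod[of y n i] x y unfolding P by metis
      qed
      then show "x = y" by blast
    qed simp
  next
    fix x assume x: "x \<in> ?P"
    then show "?f x \<in> recurrent_words G n"
      unfolding P using R[of x] nonzero_windows_iff[OF n, of x G] by simp
  next
    fix w assume w: "w \<in> recurrent_words G n"
    then have len: "length w = n" and lw: "set w \<subseteq> letters G" by (auto simp: recurrent_words_def)
    define x where "x = (\<lambda>i. w ! nat (i mod int n))"
    have inL: "\<forall>i. x i \<in> letters G"
    proof
      fix i
      have "nat (i mod int n) < length w" using n len by (simp add: nat_less_iff)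
      then show "x i \<in> letters G" using lw nth_mem unfolding x_def by blast
    qed
    have per: "\<forall>i. x (i + int n) = x i" by (simp add: x_def)
    have f: "?f x = w" by (rule nth_equalityI) (use len in \<open>auto simp: x_def\<close>)
    have "(\<forall>i j. i \<le> j \<longrightarrow> nonzero G (map x [i..j])) \<longleftrightarrow> (\<forall>k\<ge>1. nonzero G (concat (replicate k (?f x))))"
      by (rule nonzero_windows_iff[OF n]) (use per inL in auto)
    moreover have "\<forall>k\<ge>1. nonzero G (concat (replicate k (?f x)))"
      using w unfolding f by (simp add: recurrent_words_def)
    ultimately have "x \<in> ?P" unfolding P using inL per by blast
    then show "\<exists>x\<in>?P. w = ?f x"
    proof (rule bexI[of _ x, rotated])
      show "w = ?f x" by (rule f[symmetric])
    qed
  qed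
  then have "card ?P = card (recurrent_words G n)" by (rule bij_betw_same_card)
  then show ?thesis by (simp only: num_periodic_def)
qed

subsection \<open>Drift\<close>

fun weight :: "('v, 'e) gen \<Rightarrow> int" where
  "weight (Plus e) = 1" | "weight (Minus e) = - 1" | "weight (Idem v) = 0" | "weight Null = 0"

definition drift :: "('v, 'e) gen list \<Rightarrow> int" where
  "drift w = sum_list (map weight w)"

lemma drift_simps [simp]: "drift [] = 0" "drift (x # w) = weight x + drift w" "drift (u @ w) = drift u + drift w"
  by (auto simp: drift_def)

lemma weight_opp [simp]: "weight (opp x) = - weight x"
  by (cases x) auto

lemma drift_mirror [simp]: "drift (mirror w) = - drift w"
  by (induction w) auto

lemma act_drift:
  "act G x (p, h, m) = Some (p', h', m') \<Longrightarrow> int (length p') - int (length m') = int (length p) - int (length m) + weight x"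
  by (cases x; cases m) (auto split: if_splits)

text \<open>
  Cancellation removes one letter of each sign, so the drift can be read off the normal form.
\<close>

lemma run_drift:
  "run G w (p, h, m) = Some (p', h', m') \<Longrightarrow> int (length p') - int (length m') = int (length p) - int (length m) + drift w"
proof (induction w arbitrary: p h m)
  case (Cons x w)
  then obtain p1 h1 m1 where 1: "act G x (p, h, m) = Some (p1, h1, m1)" "run G w (p1, h1, m1) = Some (p', h', m')"
    by (auto split: bind_splits)
  show ?case using act_drift[OF 1(1)] Cons.IH[OF 1(2)] by simp
qed simp

lemma rising_drift: "w \<in> rising_words G v \<Longrightarrow> drift w \<ge> 0"
  using run_drift[of G w "[]" v "[]"] by (auto simp: rising_words_def)

lemma rising_drift_0: "w \<in> rising_words G v \<Longrightarrow> drift w = 0 \<Longrightarrow> w \<in> closed_words G v"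
  using run_drift[of G w "[]" v "[]"] by (auto simp: rising_words_def closed_words_def)

lemma closed_drift: "w \<in> closed_words G v \<Longrightarrow> drift w = 0"
  using run_drift[of G w "[]" v "[]"] by (auto simp: closed_words_def)

subsection \<open>Classification of recurrent words\<close>

lemma conjugatesE:
  assumes "w \<in> conjugates M n"
  obtains x y where "w = y @ x" "x @ y \<in> M" "length (x @ y) = n"
  using assms by (auto simp: conjugates_def)

lemma conjugatesI: "x @ y \<in> M \<Longrightarrow> length (x @ y) = n \<Longrightarrow> y @ x \<in> conjugates M n"
  unfolding conjugates_def by blast

lemma conjugates_rotate:
  assumes "a @ b \<in> conjugates M n"
  shows "b @ a \<in> conjugates M n"
proof -
  obtain x y where xy: "a @ b = y @ x" "x @ y \<in> M" "length (x @ y) = n" using assms by (rule conjugatesE)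
  then consider us where "a = y @ us" "us @ b = x" | us where "a @ us = y" "b = us @ x"
    unfolding append_eq_append_conv2 by blast
  then show ?thesis
  proof cases
    case (1 us)
    have "us @ (b @ y) \<in> M" "length (us @ (b @ y)) = n" using xy(2,3) unfolding 1(2)[symmetric] by simp_all
    then have "(b @ y) @ us \<in> conjugates M n" by (rule conjugatesI)
    then show ?thesis using 1(1) by simp
  next
    case (2 us)
    have "(x @ a) @ us \<in> M" "length ((x @ a) @ us) = n" using xy(2,3) unfolding 2(1)[symmetric] by simp_all
    then have "us @ (x @ a) \<in> conjugates M n" by (rule conjugatesI)
    then show ?thesis using 2(2) by simp
  qed
qed

lemma conjugates_mono: "M \<subseteq> N \<Longrightarrow> conjugates M n \<subseteq> conjugates N n"
  by (auto simp: conjugates_def)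

lemma conjugates_drift: "w \<in> conjugates M n \<Longrightarrow> \<exists>u\<in>M. drift w = drift u"
  by (erule conjugatesE) (auto intro!: bexI)

lemma replicate_rotate: "x @ concat (replicate k (y @ x)) @ y = concat (replicate (Suc k) (x @ y))"
  by (induction k) auto

text \<open>
  Powers of a rotation of \<open>w\<close> are factors of powers of \<open>w\<close>, and powers of a rising word are rising.
\<close>

lemma rising_conjugate_recurrent:
  assumes wf: "wf_digraph G" and n: "n > 0" and w: "w \<in> conjugates (rising_words G v) n"
  shows "w \<in> recurrent_words G n"
proof -
  obtain x y where xy: "w = y @ x" "x @ y \<in> rising_words G v" "length (x @ y) = n" using w by (rule conjugatesE)
  then have l: "x \<in> lists (letters G)" "y \<in> lists (letters G)" using rising_words_lists[of G v] by auto
  have pow: "concat (replicate k (x @ y)) \<in> rising_words G v" for k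
    by (induction k) (use rising_append[OF xy(2)] in auto)
  have "nonzero G (concat (replicate k w))" for k
  proof -
    have "concat (replicate (Suc k) (x @ y)) \<noteq> []" using n xy(3) by auto
    then have "nonzero G (concat (replicate (Suc k) (x @ y)))"
      using pow[of "Suc k"] nonzero_iff[OF wf, of "concat (replicate (Suc k) (x @ y))"]
      by (auto simp: rising_words_def simp del: concat.simps replicate_Suc)
    then show ?thesis
      unfolding replicate_rotate[symmetric] xy(1) by (rule nonzero_factor) (use l in auto)
  qed
  then show ?thesis using xy l by (auto simp: recurrent_words_def)
qed

lemma mirror_replicate: "mirror (concat (replicate k w)) = concat (replicate k (mirror w))"
proof (induction k)
  case (Suc k)
  have "concat (replicate (Suc k) (mirror w)) = concat (replicate k (mirror w)) @ mirror w"
    by (induction k) auto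
  with Suc show ?case by simp
qed simp

lemma mirror_recurrent: "w \<in> recurrent_words G n \<Longrightarrow> mirror w \<in> recurrent_words G n"
  by (auto simp: recurrent_words_def mirror_replicate[symmetric] simp del: in_lists_conv_set)

lemma mirror_closed:
  assumes "wf_digraph G" "v \<in> verts G" "w \<in> closed_words G v"
  shows "mirror w \<in> closed_words G v"
proof (cases "w = []")
  case False
  then have m: "mirror w \<noteq> []" by (metis length_0_conv mirror_simps(6))
  have w: "w \<in> lists (letters G)" "mirror w \<in> lists (letters G)" using assms by (auto simp: closed_words_def simp del: in_lists_conv_set)
  show ?thesis
    using gis_prod_eq_Idem_iff[OF assms(1) w(1) False assms(2)] gis_prod_eq_Idem_iff[OF assms(1) w(2) m assms(2)] assms(3) w
    by (simp add: closed_words_def gis_prod_mirror_Idem del: in_lists_conv_set)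
qed simp

lemma mirror_conjugates_closed:
  assumes "wf_digraph G" "v \<in> verts G" "w \<in> conjugates (closed_words G v) n"
  shows "mirror w \<in> conjugates (closed_words G v) n"
proof -
  obtain x y where xy: "w = y @ x" "x @ y \<in> closed_words G v" "length (x @ y) = n" using assms(3) by (rule conjugatesE)
  show ?thesis using mirror_closed[OF assms(1,2) xy(2)] xy conjugatesI[of "mirror y" "mirror x" "closed_words G v" n] by simp
qed

text \<open>
  If a word closed at \<open>u\<close> has a rotation closed at \<open>v\<close>, its prefix up to the cut leaves nothing on
  the stack and is itself closed at \<open>u\<close>, but its last letter has to end at \<open>v\<close>.
\<close>

lemma closed_conjugates_disjoint:
  assumes n: "n > 0" and uv: "u \<noteq> v"
  shows "conjugates (closed_words G u) n \<inter> conjugates (closed_words G v) n = {}"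
proof (rule ccontr)
  assume "\<not> ?thesis"
  then obtain w where w: "w \<in> conjugates (closed_words G u) n" "w \<in> conjugates (closed_words G v) n" by blast
  obtain a b where ab: "w = b @ a" "a @ b \<in> closed_words G u" "length (a @ b) = n" using w(1) by (rule conjugatesE)
  have "a @ b \<in> conjugates (closed_words G v) n" using w(2) unfolding ab(1) by (rule conjugates_rotate)
  then obtain t s where st: "a @ b = s @ t" "t @ s \<in> closed_words G v" by (rule conjugatesE)
  obtain m where m: "run G s ([], u, []) = Some ([], u, m)"
    using ab(2) unfolding st(1) closed_words_def by (auto elim: run_prefix_Nil)
  obtain m' where m': "run G t ([], v, []) = Some ([], v, m')" "run G s ([], v, m') = Some ([], v, [])"
    using st(2) unfolding closed_words_def by (auto elim: run_prefix_Nil)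
  show False
  proof (cases "s = []")
    case True
    then have t: "t \<noteq> []" "run G t ([], u, []) = Some ([], u, [])" using ab n st by (auto simp: closed_words_def)
    show False using run_src[OF t(1) t(2)] run_src[OF t(1) m'(1)] uv by simp
  next
    case False
    have "m = []" using run_stack_prefix[OF m m'(2)] by simp
    then show False using run_tgt[OF False m] run_tgt[OF False m'(2)] uv by simp
  qed
qed

text \<open>
  Cut \<open>w\<close> into \<open>w1 w2\<close>, where \<open>w1\<close> reduces to plus letters and
  \<open>w2\<close> to minus letters.  As \<open>w w\<close> is nonzero, the letters of \<open>w1\<close> cancel those of \<open>w2\<close>, and because
  the drift is nonnegative nothing remains of \<open>w2\<close>: the rotation \<open>w2 w1\<close> is rising.
\<close>

lemma recurrent_conjugate_rising:
  assumes wf: "wf_digraph G" and n: "n > 0" and w: "w \<in> recurrent_words G n" and d: "drift w \<ge> 0"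
  obtains h where "h \<in> verts G" "w \<in> conjugates (rising_words G h) n"
proof -
  have l: "w \<in> lists (letters G)" and len: "length w = n" and nz: "nonzero G (concat (replicate 2 w))"
    using w by (auto simp: recurrent_words_def simp del: in_lists_conv_set)
  have "concat (replicate 2 w) = w @ w" by (simp add: numeral_2_eq_2)
  then have "nonzero G (w @ w)" using nz by simp
  then obtain u s where s: "run G (w @ w) ([], u, []) = Some s"
    using nonzero_iff[OF wf, of "w @ w"] l len n by auto
  then obtain p h m where 1: "run G w ([], u, []) = Some (p, h, m)" "run G w (p, h, m) = Some s"
    by (auto simp: run_append split: bind_splits)
  obtain w1 w2 where w12: "w = w1 @ w2" "run G w1 ([], u, []) = Some (p, h, [])" "run G w2 ([], h, []) = Some ([], h, m)"
    using split_at_base[OF l 1(1)] .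
  have le: "length m \<le> length p" using run_drift[OF 1(1)] d by simp
  obtain s' where "run G w1 (p, h, m) = Some s'" using 1(2) w12(1) by (auto simp: run_append split: bind_splits)
  then obtain q' h' m' where q: "run G w1 ([], h, m) = Some (q', h', m')"
    unfolding run_prefix'[of G w1 p] by auto
  have l1: "w1 \<in> lists (letters G)" using l w12 by simp
  have m': "m' = []" "h' = h" using run_popping_word[OF l1 w12(2) q le] q by (cases "w1 = []"; auto)+
  then have r: "run G (w2 @ w1) ([], h, []) = Some (q', h, [])" using w12(3) q by (simp add: run_append)
  then have "w2 @ w1 \<in> rising_words G h" using l w12 by (auto simp: rising_words_def)
  then have conj: "w \<in> conjugates (rising_words G h) n" using conjugatesI[of w2 w1 _ n] w12(1) len by simp
  have ne: "w2 @ w1 \<noteq> []" using w12(1) len n by auto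
  have "hd (w2 @ w1) \<in> set (w2 @ w1)" using ne by (rule hd_in_set)
  then have "hd (w2 @ w1) \<in> letters G" using l w12(1) by auto
  then have "h \<in> verts G" using run_src[OF ne r] src_in_verts[OF wf] by simp
  then show ?thesis using that conj by blast
qed

text \<open>
  A rising word at \<open>y\<close> that is not closed passes through \<open>x\<close> immediately after its first permanent
  plus letter; rotating to that position makes it rising at \<open>x\<close>.
\<close>

lemma recurrent_nonneg_drift:
  assumes wf: "wf_digraph G" and n: "n > 0" and V: "verts G = {x, y}"
    and no_loop: "\<And>e. e \<in> arcs G \<Longrightarrow> tail G e = y \<Longrightarrow> head G e \<noteq> y"
    and w: "w \<in> recurrent_words G n" and d: "drift w \<ge> 0"
  shows "w \<in> conjugates (rising_words G x) n \<union> conjugates (closed_words G y) n"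
proof -
  obtain h where h: "h \<in> verts G" "w \<in> conjugates (rising_words G h) n"
    using recurrent_conjugate_rising[OF wf n w d] .
  show ?thesis
  proof (cases "h = x")
    case False
    then have hy: "h = y" using h V by simp
    obtain a b where ab: "w = b @ a" "a @ b \<in> rising_words G y" "length (a @ b) = n"
      using h(2) unfolding hy by (rule conjugatesE)
    show ?thesis
    proof (cases "a @ b \<in> closed_words G y")
      case True
      then show ?thesis using conjugatesI[of a b _ n] ab by simp
    next
      case False
      obtain d f w2 p where 1: "a @ b = d @ Plus f # w2" "d \<in> closed_words G y" "f \<in> arcs G" "head G f = y"
          "run G w2 ([], tail G f, []) = Some (p, y, [])"
        using rising_not_closed[OF ab(2) False] by metis
      have tf: "tail G f = x" using no_loop[of f] 1 wf V wf_digraph.tail_in_verts by fastforce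
      have "run G d (p, y, []) = Some (p, y, [])"
        using run_prefix'[of G d p y "[]"] 1(2) by (simp add: closed_words_def)
      then have "run G (w2 @ d @ [Plus f]) ([], x, []) = Some (p @ [f], x, [])"
        using 1 tf by (simp add: run_append)
      moreover have "w2 @ d @ [Plus f] \<in> lists (letters G)"
      proof -
        have "d @ Plus f # w2 \<in> lists (letters G)" using ab(2) rising_words_lists[of G y] unfolding 1(1) by blast
        then show ?thesis by auto
      qed
      ultimately have "w2 @ (d @ [Plus f]) \<in> rising_words G x" by (auto simp: rising_words_def)
      moreover have "length (w2 @ (d @ [Plus f])) = n" using ab(3) arg_cong[OF 1(1), of length] by simp
      ultimately have "(d @ [Plus f]) @ w2 \<in> conjugates (rising_words G x) n" by (rule conjugatesI)
      then have "a @ b \<in> conjugates (rising_words G x) n" using 1(1) by simp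
      then show ?thesis using conjugates_rotate ab(1) by blast
    qed
  qed (use h in auto)
qed

text \<open>
  With \<open>U\<close>, \<open>C\<close> and \<open>D\<close> the rotations of words rising at \<open>x\<close>, closed at \<open>x\<close> and closed at \<open>y\<close>, the
  recurrent words are the union of \<open>U\<close>, its mirror image and \<open>D\<close>.  The set \<open>U\<close> has nonnegative drift
  and meets its mirror image exactly in drift \<open>0\<close>, that is, in \<open>C\<close>, while \<open>D\<close> is disjoint from both.
\<close>

lemma card_recurrent:
  assumes "fin_digraph G" and n: "n > 0" and V: "verts G = {x, y}" "x \<noteq> y"
    and no_loop: "adjacency G y y = 0"
  shows "card (recurrent_words G n) + card (conjugates (closed_words G x) n) =
    2 * card (conjugates (rising_words G x) n) + card (conjugates (closed_words G y) n)"
proof -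
  interpret fin_digraph G by fact
  define R U C D where "R = recurrent_words G n" and "U = conjugates (rising_words G x) n"
    and "C = conjugates (closed_words G x) n" and "D = conjugates (closed_words G y) n"
  have nl: "head G e \<noteq> y" if "e \<in> arcs G" "tail G e = y" for e
    using no_loop that unfolding adjacency_def by auto
  have xy: "x \<in> verts G" "y \<in> verts G" using V by auto
  have driftU: "drift w \<ge> 0" if "w \<in> U" for w
    using conjugates_drift[of w _ n] that rising_drift unfolding U_def by metis
  have U0: "w \<in> C" if wU: "w \<in> U" and w0: "drift w = 0" for w
  proof -
    obtain a b where ab: "w = b @ a" "a @ b \<in> rising_words G x" "length (a @ b) = n"
      using wU unfolding U_def by (rule conjugatesE)
    have "drift (a @ b) = 0" using w0 ab(1) by simp
    then have "a @ b \<in> closed_words G x" by (rule rising_drift_0[OF ab(2)])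
    then show ?thesis unfolding C_def ab(1) using ab(3) by (rule conjugatesI)
  qed
  have drift0: "drift w = 0" if "w \<in> conjugates (closed_words G v) n" for w v
    using conjugates_drift[OF that] closed_drift by metis
  have CU: "C \<subseteq> U" unfolding C_def U_def by (rule conjugates_mono[OF closed_subset_rising])
  have mC: "mirror w \<in> C" if "w \<in> C" for w
    using mirror_conjugates_closed[OF wf_digraph xy(1)] that unfolding C_def by blast
  have mD: "mirror w \<in> D" if "w \<in> D" for w
    using mirror_conjugates_closed[OF wf_digraph xy(2)] that unfolding D_def by blast
  have CD: "C \<inter> D = {}" unfolding C_def D_def by (rule closed_conjugates_disjoint[OF n V(2)])
  have UR: "U \<subseteq> R" unfolding U_def R_def using rising_conjugate_recurrent[OF wf_digraph n] by blast
  have DR: "D \<subseteq> R"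
    using conjugates_mono[OF closed_subset_rising, of G y n] rising_conjugate_recurrent[OF wf_digraph n, of _ y]
    unfolding D_def R_def by blast
  have mR: "mirror w \<in> R" if "w \<in> R" for w using mirror_recurrent that unfolding R_def by blast
  have pos: "w \<in> U \<union> D" if "w \<in> R" "drift w \<ge> 0" for w
    using recurrent_nonneg_drift[OF wf_digraph n V(1) nl] that unfolding R_def U_def D_def by blast
  have R: "R = (U \<union> mirror ` U) \<union> D"
  proof (intro equalityI subsetI)
    fix w assume w: "w \<in> R"
    show "w \<in> (U \<union> mirror ` U) \<union> D"
    proof (cases "drift w \<ge> 0")
      case False
      then have "mirror w \<in> U \<union> D" using pos[of "mirror w"] mR[OF w] by simp
      then show ?thesis using mD[of "mirror w"] image_eqI[of w mirror "mirror w" U] by auto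
    qed (use pos[OF w] in blast)
  qed (use UR DR mR in auto)
  have int: "U \<inter> mirror ` U = C"
  proof (intro equalityI subsetI)
    fix w assume "w \<in> U \<inter> mirror ` U"
    then obtain u where u: "w \<in> U" "u \<in> U" "w = mirror u" by blast
    then have "drift w = 0" using driftU[of w] driftU[of u] by simp
    then show "w \<in> C" using U0 u by blast
  next
    fix w assume "w \<in> C"
    then show "w \<in> U \<inter> mirror ` U" using CU mC[of w] image_eqI[of w mirror "mirror w" U] by auto
  qed
  have UD: "w \<notin> D" if "w \<in> U" for w
    using that U0[of w] drift0[of w y] CD unfolding D_def by blast
  have disj: "(U \<union> mirror ` U) \<inter> D = {}"
  proof -
    have "mirror u \<notin> D" if "u \<in> U" for u using UD[OF that] mD[of "mirror u"] by auto
    then show ?thesis using UD by blast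
  qed
  have finU: "finite U" unfolding U_def
    using pure_submonoid.finite_conjugates[OF pure_submonoid_rising[OF finite_arcs]] .
  have finD: "finite D" unfolding D_def
    using pure_submonoid.finite_conjugates[OF pure_submonoid_closed[OF finite_arcs]] .
  have "inj_on mirror U" by (metis inj_onI mirror_simps(5))
  then have "card (mirror ` U) = card U" by (rule card_image)
  moreover have "card U + card (mirror ` U) = card (U \<union> mirror ` U) + card C"
    using card_Un_Int[OF finU finite_imageI[OF finU, of mirror]] unfolding int .
  moreover have "card R = card (U \<union> mirror ` U) + card D"
    unfolding R by (rule card_Un_disjoint) (use finU finD disj in auto)
  ultimately show ?thesis unfolding R_def U_def C_def D_def by simp
qed

section \<open>The zeta function\<close>

text \<open>
  Prefixes of length at least \<open>1\<close> are nonempty, where having the product \<open>P\<^sub>v\<close> and being closed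
  at \<open>v\<close> agree.
\<close>

lemma markov_dyck_code_eq:
  assumes wf: "wf_digraph G" and v: "v \<in> verts G"
  shows "markov_dyck_code G v = primes (closed_words G v)"
proof -
  have *: "gis_prod G w = gis_prod G [Idem v] \<longleftrightarrow> w \<in> closed_words G v"
    if "w \<in> lists (letters G)" "w \<noteq> []" for w
    using gis_prod_eq_Idem_iff[OF wf that v] that by (simp add: closed_words_def)
  have t: "gis_prod G (take j w) = gis_prod G [Idem v] \<longleftrightarrow> take j w \<in> closed_words G v"
    if "w \<in> lists (letters G)" "w \<noteq> []" "1 \<le> j" for j w
    by (rule *) (use that in \<open>auto dest: in_set_takeD\<close>)
  show ?thesis
    unfolding markov_dyck_code_def primes_def using * t closed_words_lists[of G v] by blast
qed

text \<open>
  Comparing coefficients at \<open>n\<close>, the left side is \<open>n Y\<^sub>n\<close>, and the right side involves only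
  coefficients of \<open>Y\<close> of smaller index.
\<close>

lemma fps_euler_unique:
  fixes Y S :: "complex fps"
  assumes ode: "fps_X * fps_deriv Y = S * Y" and "S $ 0 = 0" "Y $ 0 = 0"
  shows "Y = 0"
proof (rule fps_ext)
  fix n
  show "Y $ n = 0 $ n"
  proof (induction n rule: less_induct)
    case (less n)
    show ?case
    proof (cases n)
      case (Suc k)
      have "S $ i * Y $ (n - i) = 0" if "i \<le> n" for i
        using less[of "n - i"] that assms(2) Suc by (cases "i = 0") auto
      then have "(S * Y) $ n = 0" by (auto simp: fps_mult_nth intro!: sum.neutral)
      moreover have "(fps_X * fps_deriv Y) $ n = of_nat n * Y $ n" using Suc by simp
      ultimately have "of_nat n * Y $ n = 0" using ode by metis
      then show ?thesis using Suc by (simp del: of_nat_Suc)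
    qed (use assms in simp)
  qed
qed

text \<open>
  Both sides solve \<open>z Y' = - L1 Y\<close> with constant term \<open>1\<close>.
\<close>

lemma exp_log_derivative:
  fixes F :: "complex fps"
  assumes F: "F $ 0 = 0" "fps_X * fps_deriv F = 2 * L0 - L1 + L2"
    and L: "L0 * (1 - g0) = fps_X * fps_deriv g0" "L1 * (1 - g1) = fps_X * fps_deriv g1"
      "L2 * (1 - g2) = fps_X * fps_deriv g2"
    and g: "g0 $ 0 = 0" "g1 $ 0 = 0" "g2 $ 0 = 0" and L1: "L1 $ 0 = 0"
  shows "(fps_exp 1 oo F) * (1 - g0) ^ 2 * (1 - g2) = 1 - g1"
proof -
  let ?E = "fps_exp 1 oo F"
  let ?Y = "?E * (1 - g0) ^ 2 * (1 - g2) - (1 - g1)"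
  have E': "fps_deriv ?E = ?E * fps_deriv F"
    using fps_compose_deriv[OF F(1), of "fps_exp 1"] by simp
  have Y': "fps_deriv ?Y = ?E * fps_deriv F * (1 - g0) ^ 2 * (1 - g2)
      - 2 * ?E * (1 - g0) * fps_deriv g0 * (1 - g2) - ?E * (1 - g0) ^ 2 * fps_deriv g2 + fps_deriv g1"
    by (simp add: E' power2_eq_square algebra_simps)
  have "fps_X * fps_deriv ?Y = - L1 * ?Y"
    unfolding Y' using F(2) L by algebra
  moreover have "?Y $ 0 = 0" using g by (simp add: power2_eq_square)
  ultimately have "?Y = 0" using L1 by (intro fps_euler_unique[of ?Y "- L1"]) auto
  then show ?thesis by simp
qed

lemma zeta_markov_dyck:
  assumes "fin_digraph G" and V: "verts G = {x, y}" "x \<noteq> y" and no_loop: "adjacency G y y = 0"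
  shows "zeta (markov_dyck_shift G) * (1 - gen_fun (primes (rising_words G x))) ^ 2
      * (1 - gen_fun (primes (closed_words G y))) = 1 - gen_fun (primes (closed_words G x))"
proof -
  interpret fin_digraph G by fact
  define L where "L M = Abs_fps (\<lambda>n. if n = 0 then 0 else of_nat (card (conjugates M n)) :: complex)"
    for M :: "('a, 'b) gen list set"
  define F where "F = Abs_fps (\<lambda>n. if n = 0 then 0 else
      of_nat (num_periodic (markov_dyck_shift G) n) / of_nat n :: complex)"
  have L: "L (rising_words G v) * (1 - gen_fun (primes (rising_words G v))) = fps_X * fps_deriv (gen_fun (primes (rising_words G v)))"
    "L (closed_words G v) * (1 - gen_fun (primes (closed_words G v))) = fps_X * fps_deriv (gen_fun (primes (closed_words G v)))" for v
    unfolding L_def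
    by (rule pure_submonoid.conjugates_fps[OF pure_submonoid_rising[OF finite_arcs]]
             pure_submonoid.conjugates_fps[OF pure_submonoid_closed[OF finite_arcs]])+
  have F: "fps_X * fps_deriv F = 2 * L (rising_words G x) - L (closed_words G x) + L (closed_words G y)"
  proof (rule fps_ext)
    fix n
    show "(fps_X * fps_deriv F) $ n = (2 * L (rising_words G x) - L (closed_words G x) + L (closed_words G y)) $ n"
    proof (cases "n = 0")
      case False
      have "(fps_X * fps_deriv F) $ n = of_nat n * F $ n" using False by (cases n) simp_all
      also have "\<dots> = of_nat (card (recurrent_words G n))"
        using False num_periodic_markov_dyck[of n G] by (simp add: F_def)
      also have "\<dots> = 2 * of_nat (card (conjugates (rising_words G x) n))
          - of_nat (card (conjugates (closed_words G x) n)) + of_nat (card (conjugates (closed_words G y) n))"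
        using arg_cong[OF card_recurrent[OF assms(1) _ V no_loop, of n], of "of_nat :: nat \<Rightarrow> complex"] False
        by (simp add: algebra_simps)
      finally show ?thesis using False by (simp add: L_def numeral_fps_const)
    qed (simp add: L_def)
  qed
  have "(fps_exp 1 oo F) * (1 - gen_fun (primes (rising_words G x))) ^ 2
      * (1 - gen_fun (primes (closed_words G y))) = 1 - gen_fun (primes (closed_words G x))"
    by (rule exp_log_derivative[OF _ F L(1) L(2) L(2) gen_fun_primes_0 gen_fun_primes_0 gen_fun_primes_0]) (simp_all add: F_def L_def)
  then show ?thesis unfolding zeta_def F_def .
qed

theorem mainTheorem5:
  fixes G :: "(nat, 'e) pre_digraph" and a b c :: nat
  assumes "1 \<le> a" and "1 \<le> b" and "1 \<le> c"
    and "fin_digraph G" and "verts G = {1, 2}"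
    and "adjacency G 1 1 = a" and "adjacency G 1 2 = b"
    and "adjacency G 2 1 = c" and "adjacency G 2 2 = 0"
  shows "let z = (fps_X :: complex fps);
             A = (of_nat a :: complex fps); B = (of_nat b :: complex fps); C = (of_nat c :: complex fps);
             g = gen_fun (markov_dyck_code G 2);
             N = C * g * (1 - g);
             D = A * g ^ 2 - (A + C * (1 + B) * z) * g + C * z
         in (\<forall>h :: complex fps.
               fps_nth h 0 = 0 \<and>
               A * h ^ 3 - (A + C) * h ^ 2 + C * (1 + (C - B) * z ^ 2) * h - C ^ 2 * z ^ 2 = 0
               \<longleftrightarrow> h = g) \<and>
            D ^ 2 dvd N \<and> zeta (markov_dyck_shift G) = N / D ^ 2"
proof -
  interpret fin_digraph G by fact
  define z A B C where "z = (fps_X :: complex fps)" and "A = (of_nat a :: complex fps)"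
    and "B = (of_nat b :: complex fps)" and "C = (of_nat c :: complex fps)"
  define g g1 gr where "g = gen_fun (markov_dyck_code G 2)"
    and "g1 = gen_fun (primes (closed_words G 1))" and "gr = gen_fun (primes (rising_words G 1))"
  define D1 D2 where "D1 = gen_fun (closed_words G 1)" and "D2 = gen_fun (closed_words G 2)"
  define N D where "N = C * g * (1 - g)" and "D = A * g ^ 2 - (A + C * (1 + B) * z) * g + C * z"
  define E where "E = zeta (markov_dyck_shift G)"
  have g: "g = gen_fun (primes (closed_words G 2))"
    unfolding g_def using markov_dyck_code_eq[OF wf_digraph, of 2] assms(5) by simp
  note gf = pure_submonoid.gen_fun_submonoid[OF pure_submonoid_closed[OF finite_arcs]]
  have D: "D1 * (1 - g1) = 1" "D2 * (1 - g) = 1"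
    unfolding g D1_def D2_def g1_def by (rule gf)+
  have "g1 = z ^ 2 * (A * D1 + B * D2)" "g = z ^ 2 * (C * D1)"
    using gen_fun_primes_closed[OF assms(4,5), of 1] gen_fun_primes_closed[OF assms(4,5), of 2] assms(6-9)
    unfolding g g1_def D1_def D2_def z_def A_def B_def C_def by simp_all
  note eqs = this
  have "gr = g1 + A * z + B * C * z ^ 2 * D2"
    using gen_fun_primes_rising[OF assms(4,5) _ assms(9)] assms(6-9)
    unfolding gr_def g1_def D2_def z_def A_def B_def C_def by simp
  note eqr = this
  have zeta: "E * (1 - gr) ^ 2 * (1 - g) = 1 - g1"
    unfolding E_def gr_def g g1_def by (rule zeta_markov_dyck[OF assms(4,5) _ assms(9)]) simp
  \<comment> \<open>Eliminating \<open>D1\<close>; then \<open>D2\<close> is eliminated with its own equation in the next two steps.\<close>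
  have g1: "g * (1 - g1) = C * z ^ 2" using eqs(2) D(1) by algebra
  have cubic: "A * g ^ 3 - (A + C) * g ^ 2 + C * (1 + (C - B) * z ^ 2) * g - C ^ 2 * z ^ 2 = 0"
  proof -
    have "C * g1 * (1 - g) = A * g * (1 - g) + B * C * z ^ 2" using eqs D(2) by algebra
    then show ?thesis using g1 by algebra
  qed
  have zD: "g * (1 - gr) * (1 - g) = z * D"
  proof -
    have "(1 - gr) * (1 - g) = (1 - g1 - A * z) * (1 - g) - B * C * z ^ 2"
      using eqr D(2) by algebra
    then show ?thesis unfolding D_def using g1 by algebra
  qed
  have z0: "z \<noteq> 0" by (simp add: z_def)
  have C0: "C \<noteq> 0" using assms(3) by (simp add: C_def)
  \<comment> \<open>\<open>D\<close> is nonzero because the left side of \<open>zD\<close> is a product of nonzero series.\<close>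
  have "fps_nth (1 - gr) 0 \<noteq> 0" "fps_nth (1 - g) 0 \<noteq> 0" by (simp_all add: gr_def g gen_fun_primes_0)
  then have "1 - gr \<noteq> 0" "1 - g \<noteq> 0" by (metis fps_zero_nth)+
  moreover have "g \<noteq> 0" using g1 z0 C0 by auto
  ultimately have "z * D \<noteq> 0" unfolding zD[symmetric] by simp
  then have D0: "D \<noteq> 0" by auto
  have "z ^ 2 * N = z ^ 2 * (E * D ^ 2)"
  proof -
    have "z ^ 2 * (E * D ^ 2) = E * (g * (1 - gr) * (1 - g)) ^ 2" unfolding zD by algebra
    also have "\<dots> = g * (1 - g) * (g * (1 - g1))" using zeta by algebra
    also have "\<dots> = z ^ 2 * N" unfolding g1 N_def by algebra
    finally show ?thesis by (rule sym)
  qed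
  then have N: "N = E * D ^ 2" using z0 by simp
  have "h = g" if h0: "fps_nth h 0 = 0"
    and h: "A * h ^ 3 - (A + C) * h ^ 2 + C * (1 + (C - B) * z ^ 2) * h - C ^ 2 * z ^ 2 = 0" for h
  proof -
    \<comment> \<open>\<open>?Q\<close> is the difference quotient of the cubic; its constant term is \<open>c\<close>.\<close>
    let ?Q = "A * (h ^ 2 + h * g + g ^ 2) - (A + C) * (h + g) + C * (1 + (C - B) * z ^ 2)"
    have "(h - g) * ?Q = 0" using h cubic by algebra
    moreover have "fps_nth ?Q 0 = of_nat c"
      using h0 by (simp add: g gen_fun_primes_0 z_def C_def power2_eq_square)
    then have "?Q \<noteq> 0" using assms(3) by (metis fps_zero_nth of_nat_eq_0_iff not_one_le_zero)
    ultimately show ?thesis by simp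
  qed
  moreover have "fps_nth g 0 = 0" by (simp add: g gen_fun_primes_0)
  ultimately have "\<forall>h. fps_nth h 0 = 0 \<and>
       A * h ^ 3 - (A + C) * h ^ 2 + C * (1 + (C - B) * z ^ 2) * h - C ^ 2 * z ^ 2 = 0 \<longleftrightarrow> h = g"
    using cubic by blast
  moreover have "D ^ 2 dvd N" "E = N / D ^ 2" using N D0 by simp_all
  ultimately show ?thesis
    unfolding Let_def N_def D_def E_def g_def z_def A_def B_def C_def by blast
qed

end
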